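(* The following two assertions are equivalent: (i) the delooping level of every Artin algebra is finite; (ii) for every Artin algebra $A$, if $\mathrm{del}(A)<\infty$, then $\mathrm{del}(A^{\mathrm{op}})<\infty$.
   Context: $A^{\mathrm{op}}$ denotes the opposite algebra of $A$. All modules are finitely generated right modules. For a finitely generated right $A$-module $X$, let $\Omega^d(X)$ denote the $d$-th syzygy of $X$ (taken via projective covers, $\Omega^0(X)=X$). Put $$\mathrm{del}(X):=\min\{d\ge 0\mid \Omega^d(X)\text{ is (isomorphic to) a direct summand of }P\oplus\Omega^{d+1}(M)\text{ for some finitely generated projective right }A\text{-module }P\text{ and some finitely generated right }A\text{-module }M\},$$ and $\mathrm{del}(X):=\infty$ if no such $d$ exists. The delooping level of the algebra is $\mathrm{del}(A):=\max\{\mathrm{del}(S)\mid S\text{ a simple right }A\text{-module}\}$. *)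

theory Defs
  imports "HOL-Algebra.Module" "HOL-Algebra.Ideal" "HOL-Library.Extended_Nat"
begin

section \<open>Right modules\<close>

text \<open>
  The record \<^type>\<open>module\<close> of the library is reused for right modules over a not
  necessarily commutative ring \<open>A\<close>: the term \<open>a \<odot>\<^bsub>M\<^esub> x\<close> stands for the right action
  \<open>x \<cdot> a\<close>, which explains the order of the factors in \<open>ract_assoc\<close>. As usual for this
  record, the fields \<open>mult\<close> and \<open>one\<close> of a module carry no meaning.
  The library's predicate \<^const>\<open>submodule\<close> (an additive subgroup closed under
  the action) makes sense verbatim for right modules.
\<close>

locale right_module = R?: ring A + M?: abelian_group M
  for A :: "('a, 'c) ring_scheme" (structure)
    and M :: "('a, 'm, 'd) module_scheme" (structure) +
  assumes ract_closed:
      "\<lbrakk>a \<in> carrier A; x \<in> carrier M\<rbrakk> \<Longrightarrow> a \<odot>\<^bsub>M\<^esub> x \<in> carrier M"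
    and ract_add_ring:
      "\<lbrakk>a \<in> carrier A; b \<in> carrier A; x \<in> carrier M\<rbrakk>
        \<Longrightarrow> (a \<oplus>\<^bsub>A\<^esub> b) \<odot>\<^bsub>M\<^esub> x = a \<odot>\<^bsub>M\<^esub> x \<oplus>\<^bsub>M\<^esub> b \<odot>\<^bsub>M\<^esub> x"
    and ract_add_module:
      "\<lbrakk>a \<in> carrier A; x \<in> carrier M; y \<in> carrier M\<rbrakk>
        \<Longrightarrow> a \<odot>\<^bsub>M\<^esub> (x \<oplus>\<^bsub>M\<^esub> y) = a \<odot>\<^bsub>M\<^esub> x \<oplus>\<^bsub>M\<^esub> a \<odot>\<^bsub>M\<^esub> y"
    and ract_assoc:
      "\<lbrakk>a \<in> carrier A; b \<in> carrier A; x \<in> carrier M\<rbrakk>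
        \<Longrightarrow> (a \<otimes>\<^bsub>A\<^esub> b) \<odot>\<^bsub>M\<^esub> x = b \<odot>\<^bsub>M\<^esub> (a \<odot>\<^bsub>M\<^esub> x)"
    and ract_one:
      "x \<in> carrier M \<Longrightarrow> \<one>\<^bsub>A\<^esub> \<odot>\<^bsub>M\<^esub> x = x"

definition restr_module :: "('a, 'm) module \<Rightarrow> 'm set \<Rightarrow> ('a, 'm) module" where
  "restr_module M N = M\<lparr>carrier := N\<rparr>"

definition fin_gen :: "('a, 'c) ring_scheme \<Rightarrow> ('a, 'm) module \<Rightarrow> bool" where
  "fin_gen A M \<longleftrightarrow>
    (\<exists>G. finite G \<and> G \<subseteq> carrier M \<and>
      (\<forall>N. submodule N A M \<longrightarrow> G \<subseteq> N \<longrightarrow> N = carrier M))"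

definition fg_right_module :: "('a, 'c) ring_scheme \<Rightarrow> ('a, 'm) module \<Rightarrow> bool" where
  "fg_right_module A M \<longleftrightarrow> right_module A M \<and> fin_gen A M"

definition simple_right_module :: "('a, 'c) ring_scheme \<Rightarrow> ('a, 'm) module \<Rightarrow> bool" where
  "simple_right_module A S \<longleftrightarrow>
    right_module A S \<and> carrier S \<noteq> {\<zero>\<^bsub>S\<^esub>} \<and>
    (\<forall>N. submodule N A S \<longrightarrow> N = {\<zero>\<^bsub>S\<^esub>} \<or> N = carrier S)"

definition rmod_hom ::
  "('a, 'c) ring_scheme \<Rightarrow> ('a, 'm) module \<Rightarrow> ('a, 'n) module \<Rightarrow> ('m \<Rightarrow> 'n) set" where
  "rmod_hom A M N =
    {f. f \<in> carrier M \<rightarrow> carrier N \<and>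
      (\<forall>x\<in>carrier M. \<forall>y\<in>carrier M. f (x \<oplus>\<^bsub>M\<^esub> y) = f x \<oplus>\<^bsub>N\<^esub> f y) \<and>
      (\<forall>a\<in>carrier A. \<forall>x\<in>carrier M. f (a \<odot>\<^bsub>M\<^esub> x) = a \<odot>\<^bsub>N\<^esub> f x)}"

definition rmod_isomorphic ::
  "('a, 'c) ring_scheme \<Rightarrow> ('a, 'm) module \<Rightarrow> ('a, 'n) module \<Rightarrow> bool" where
  "rmod_isomorphic A M N \<longleftrightarrow>
    (\<exists>f \<in> rmod_hom A M N. bij_betw f (carrier M) (carrier N))"

definition rmod_sum :: "('a, 'm) module \<Rightarrow> ('a, 'n) module \<Rightarrow> ('a, 'm \<times> 'n) module" where
  "rmod_sum M N =
    \<lparr>carrier = carrier M \<times> carrier N,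
     mult = undefined,
     one = undefined,
     zero = (\<zero>\<^bsub>M\<^esub>, \<zero>\<^bsub>N\<^esub>),
     add = (\<lambda>(x, y) (x', y'). (x \<oplus>\<^bsub>M\<^esub> x', y \<oplus>\<^bsub>N\<^esub> y')),
     smult = (\<lambda>a (x, y). (a \<odot>\<^bsub>M\<^esub> x, a \<odot>\<^bsub>N\<^esub> y))\<rparr>"

definition iso_direct_summand ::
  "('a, 'c) ring_scheme \<Rightarrow> ('a, 'm) module \<Rightarrow> ('a, 'n) module \<Rightarrow> bool" where
  "iso_direct_summand A X Y \<longleftrightarrow>
    (\<exists>U V. submodule U A Y \<and> submodule V A Y \<and>
      U <+>\<^bsub>Y\<^esub> V = carrier Y \<and> U \<inter> V = {\<zero>\<^bsub>Y\<^esub>} \<and>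
      rmod_isomorphic A X (restr_module Y U))"


section \<open>Projective covers and syzygies\<close>

text \<open>
  A finitely generated right \<open>A\<close>-module is isomorphic to a quotient \<open>A\<^sup>n / K\<close>. Writing
  elements of \<open>A\<^sup>n\<close> as functions on \<open>nat\<close>, its elements become sets of functions.
  Hence every finitely generated right module over a ring with elements in \<open>'a\<close> has an
  isomorphic copy of the following type, which is therefore large enough to
  quantify over all finitely generated modules up to isomorphism.
\<close>

type_synonym 'a rmod = "('a, (nat \<Rightarrow> 'a) set) module"

definition projective_rmod :: "('a, 'c) ring_scheme \<Rightarrow> 'a rmod \<Rightarrow> bool" where
  "projective_rmod A P \<longleftrightarrow>
    right_module A P \<and>
    (\<forall>(N :: 'a rmod) (N' :: 'a rmod) g f.
      right_module A N \<and> right_module A N' \<and>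
      g \<in> rmod_hom A N N' \<and> g ` carrier N = carrier N' \<and> f \<in> rmod_hom A P N' \<longrightarrow>
      (\<exists>h \<in> rmod_hom A P N. \<forall>x\<in>carrier P. g (h x) = f x))"

definition superfluous ::
  "('a, 'c) ring_scheme \<Rightarrow> ('a, 'm) module \<Rightarrow> 'm set \<Rightarrow> bool" where
  "superfluous A M K \<longleftrightarrow>
    submodule K A M \<and>
    (\<forall>N. submodule N A M \<longrightarrow> K <+>\<^bsub>M\<^esub> N = carrier M \<longrightarrow> N = carrier M)"

definition projective_cover ::
  "('a, 'c) ring_scheme \<Rightarrow> 'a rmod \<Rightarrow> ((nat \<Rightarrow> 'a) set \<Rightarrow> (nat \<Rightarrow> 'a) set) \<Rightarrow> 'a rmod \<Rightarrow> bool"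
where
  "projective_cover A P p X \<longleftrightarrow>
    fg_right_module A P \<and> projective_rmod A P \<and>
    p \<in> rmod_hom A P X \<and> p ` carrier P = carrier X \<and>
    superfluous A P (a_kernel P X p)"

text \<open>
  Syzygies are determined only up to isomorphism, so they are given by a relation:
  \<open>syzygy A d X Y\<close> says that \<open>Y\<close> is obtained from \<open>X\<close> by taking \<open>d\<close> times the kernel of
  some projective cover.
\<close>

inductive syzygy :: "('a, 'c) ring_scheme \<Rightarrow> nat \<Rightarrow> 'a rmod \<Rightarrow> 'a rmod \<Rightarrow> bool"
  for A :: "('a, 'c) ring_scheme"
where
  syzygy_0: "syzygy A 0 X X"
| syzygy_Suc: "syzygy A d X Y \<Longrightarrow> projective_cover A P p Y \<Longrightarrow>
    syzygy A (Suc d) X (restr_module P (a_kernel P Y p))"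


section \<open>The delooping level\<close>

definition deloops_at :: "('a, 'c) ring_scheme \<Rightarrow> 'a rmod \<Rightarrow> nat \<Rightarrow> bool" where
  "deloops_at A X d \<longleftrightarrow>
    (\<exists>(K :: 'a rmod) (P :: 'a rmod) (M :: 'a rmod) (L :: 'a rmod).
      syzygy A d X K \<and>
      fg_right_module A P \<and> projective_rmod A P \<and>
      fg_right_module A M \<and> syzygy A (d + 1) M L \<and>
      iso_direct_summand A K (rmod_sum P L))"

text \<open>In \<^typ>\<open>enat\<close>, the infimum of the empty set is \<open>\<infinity>\<close>, and otherwise it is the minimum.\<close>

definition del_module :: "('a, 'c) ring_scheme \<Rightarrow> 'a rmod \<Rightarrow> enat" where
  "del_module A X = Inf {enat d | d. deloops_at A X d}"

text \<open>
  An Artin algebra has only finitely many simple modules up to isomorphism, so the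
  supremum is a maximum. For the zero algebra, which has no simple module, it is \<open>0\<close>.
\<close>

definition del :: "('a, 'c) ring_scheme \<Rightarrow> enat" where
  "del A = Sup {del_module A S | S :: 'a rmod. simple_right_module A S}"


section \<open>Artin algebras\<close>

definition artinian_cring :: "('r, 'c) ring_scheme \<Rightarrow> bool" where
  "artinian_cring R \<longleftrightarrow>
    cring R \<and>
    (\<forall>I :: nat \<Rightarrow> 'r set.
      (\<forall>n. ideal (I n) R) \<and> (\<forall>n. I (Suc n) \<subseteq> I n) \<longrightarrow> (\<exists>n. \<forall>m\<ge>n. I m = I n))"

text \<open>
  The library's locale \<^locale>\<open>Module.algebra\<close> is restricted to commutative algebras. Here an
  algebra over the commutative ring \<open>R\<close> is associative and unital, but not
  necessarily commutative; \<^const>\<open>smult\<close> is the action of \<open>R\<close>.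
\<close>

locale assoc_algebra = Module.module R A + ring A
  for R :: "('r, 'c) ring_scheme" and A :: "('r, 'a) module" +
  assumes smult_mult_left:
      "\<lbrakk>r \<in> carrier R; x \<in> carrier A; y \<in> carrier A\<rbrakk>
        \<Longrightarrow> (r \<odot>\<^bsub>A\<^esub> x) \<otimes>\<^bsub>A\<^esub> y = r \<odot>\<^bsub>A\<^esub> (x \<otimes>\<^bsub>A\<^esub> y)"
    and smult_mult_right:
      "\<lbrakk>r \<in> carrier R; x \<in> carrier A; y \<in> carrier A\<rbrakk>
        \<Longrightarrow> x \<otimes>\<^bsub>A\<^esub> (r \<odot>\<^bsub>A\<^esub> y) = r \<odot>\<^bsub>A\<^esub> (x \<otimes>\<^bsub>A\<^esub> y)"

definition artin_algebra :: "('r, 'c) ring_scheme \<Rightarrow> ('r, 'a) module \<Rightarrow> bool" where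
  "artin_algebra R A \<longleftrightarrow> artinian_cring R \<and> assoc_algebra R A \<and> fin_gen R A"

definition op_algebra :: "('r, 'a) module \<Rightarrow> ('r, 'a) module" where
  "op_algebra A = A\<lparr>mult := \<lambda>x y. y \<otimes>\<^bsub>A\<^esub> x\<rparr>"

end

theory Submission
  imports Defs
begin

text \<open>
  For (ii) implies (i), let \<open>A\<close> be an Artin algebra with radical \<open>J\<close> and let \<open>B\<close> be the triangular
  matrix algebra \<open>[[\<Lambda>, A/J], [0, A]]\<close>, where \<open>\<Lambda> = A \<ltimes> A/J\<close> is the trivial extension and
  acts on \<open>A/J\<close> through \<open>A\<close>. Every simple right \<open>B\<close>-module embeds in one of the two copies of
  \<open>A/J\<close> in \<open>B\<close>, which form a nilpotent ideal, so it is a first syzygy and \<open>del B = 0\<close>.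
  On the other side, \<open>A\<^sup>o\<^sup>p\<close> is a corner of \<open>B\<^sup>o\<^sup>p\<close> such that cutting down to the corner is
  exact and preserves projective covers, hence syzygies and direct summands. Every simple
  \<open>A\<^sup>o\<^sup>p\<close>-module is the corner of its inflation, so \<open>del A\<^sup>o\<^sup>p \<le> del B\<^sup>o\<^sup>p\<close>, and the latter is
  finite by (ii) because \<open>del B = 0\<close>. Starting from \<open>A\<^sup>o\<^sup>p\<close> instead of \<open>A\<close> gives (i).
\<close>

section \<open>Right modules\<close>

text \<open>The trivial extension \<open>\<Lambda>\<close> alone would already place the simple
  right modules in a nilpotent ideal, but \<open>A\<close> is only a quotient of
  \<open>\<Lambda>\<close>: in general neither restriction along the quotient map nor base change
  carries projective covers together with their kernels. So a copy of \<open>A/J\<close> is put off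
  the diagonal, where it receives the simple right modules of \<open>A\<close> while the second row
  of the matrices stays \<open>(0, A)\<close>; this row is what makes the opposite of
  \<open>A\<close> a well-behaved corner of the opposite of \<open>B\<close>. The construction is
  one-sided on purpose: right modules see the upper right entry, the corner does not. The price is a
  second family of simple modules, belonging to the upper diagonal entry. With \<open>A\<close>
  there they might have no place in the radical; with \<open>\<Lambda>\<close> they embed in its
  copy of \<open>A/J\<close>. The chain condition on \<open>A\<close> enters through the fact that
  \<open>A/J\<close> contains every simple right module.\<close>

lemma (in abelian_group) add_diff_cancel:
  "x \<in> carrier G \<Longrightarrow> y \<in> carrier G \<Longrightarrow> y \<oplus> (x \<ominus> y) = x"
  by (simp add: minus_eq a_lcomm[of y x] r_neg)

lemma (in abelian_group) diff_eq_zero_iff: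
  assumes "x \<in> carrier G" "y \<in> carrier G"
  shows "x \<ominus> y = \<zero> \<longleftrightarrow> x = y"
  using assms add_diff_cancel[of x y] by (auto simp: minus_eq r_neg)

context right_module
begin

lemma ract_zero_right: "a \<in> carrier A \<Longrightarrow> a \<odot>\<^bsub>M\<^esub> \<zero>\<^bsub>M\<^esub> = \<zero>\<^bsub>M\<^esub>"
  using ract_add_module[of a "\<zero>\<^bsub>M\<^esub>" "\<zero>\<^bsub>M\<^esub>"] ract_closed[of a "\<zero>\<^bsub>M\<^esub>"]
  by (metis M.zero_closed M.l_zero M.add.r_cancel_one')

lemma ract_zero_left: "x \<in> carrier M \<Longrightarrow> \<zero>\<^bsub>A\<^esub> \<odot>\<^bsub>M\<^esub> x = \<zero>\<^bsub>M\<^esub>"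
  using ract_add_ring[of "\<zero>\<^bsub>A\<^esub>" "\<zero>\<^bsub>A\<^esub>" x] ract_closed[of "\<zero>\<^bsub>A\<^esub>" x]
  by (metis R.zero_closed R.l_zero M.add.r_cancel_one')

lemma ract_minus_left:
  assumes "a \<in> carrier A" "x \<in> carrier M"
  shows "(\<ominus>\<^bsub>A\<^esub> a) \<odot>\<^bsub>M\<^esub> x = \<ominus>\<^bsub>M\<^esub> (a \<odot>\<^bsub>M\<^esub> x)"
proof (rule M.add.inv_equality[symmetric])
  show "(\<ominus>\<^bsub>A\<^esub> a) \<odot>\<^bsub>M\<^esub> x \<oplus>\<^bsub>M\<^esub> a \<odot>\<^bsub>M\<^esub> x = \<zero>\<^bsub>M\<^esub>"
    using assms ract_add_ring[of "\<ominus>\<^bsub>A\<^esub> a" a x] by (simp add: R.l_neg ract_zero_left)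
qed (use assms ract_closed in auto)

lemma ract_minus_right:
  assumes "a \<in> carrier A" "x \<in> carrier M"
  shows "a \<odot>\<^bsub>M\<^esub> (\<ominus>\<^bsub>M\<^esub> x) = \<ominus>\<^bsub>M\<^esub> (a \<odot>\<^bsub>M\<^esub> x)"
proof (rule M.add.inv_equality[symmetric])
  show "a \<odot>\<^bsub>M\<^esub> (\<ominus>\<^bsub>M\<^esub> x) \<oplus>\<^bsub>M\<^esub> a \<odot>\<^bsub>M\<^esub> x = \<zero>\<^bsub>M\<^esub>"
    using assms ract_add_module[of a "\<ominus>\<^bsub>M\<^esub> x" x] by (simp add: M.l_neg ract_zero_right)
qed (use assms ract_closed in auto)

lemma ract_diff_right:
  assumes "a \<in> carrier A" "x \<in> carrier M" "y \<in> carrier M"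
  shows "a \<odot>\<^bsub>M\<^esub> (x \<ominus>\<^bsub>M\<^esub> y) = a \<odot>\<^bsub>M\<^esub> x \<ominus>\<^bsub>M\<^esub> a \<odot>\<^bsub>M\<^esub> y"
  using assms by (simp add: M.minus_eq ract_add_module ract_minus_right)

lemma ract_diff_left:
  assumes "a \<in> carrier A" "b \<in> carrier A" "x \<in> carrier M"
  shows "(a \<ominus>\<^bsub>A\<^esub> b) \<odot>\<^bsub>M\<^esub> x = a \<odot>\<^bsub>M\<^esub> x \<ominus>\<^bsub>M\<^esub> b \<odot>\<^bsub>M\<^esub> x"
  using assms by (simp add: R.minus_eq M.minus_eq ract_add_ring ract_minus_left)

text \<open>Closure under negation comes for free, since \<open>-x = x \<cdot> (-1)\<close>.\<close>

lemma submodule_iff: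
  "submodule N A M \<longleftrightarrow> N \<subseteq> carrier M \<and> \<zero>\<^bsub>M\<^esub> \<in> N \<and>
    (\<forall>x\<in>N. \<forall>y\<in>N. x \<oplus>\<^bsub>M\<^esub> y \<in> N) \<and> (\<forall>a\<in>carrier A. \<forall>x\<in>N. a \<odot>\<^bsub>M\<^esub> x \<in> N)"
  (is "?L \<longleftrightarrow> ?R")
proof
  assume ?L
  then interpret N: submodule N A M .
  show ?R
    using N.subset N.one_closed N.m_closed N.smult_closed by auto
next
  assume R: ?R
  have "\<ominus>\<^bsub>M\<^esub> x \<in> N" if "x \<in> N" for x
  proof -
    have x: "x \<in> carrier M" using that R by auto
    then have "\<ominus>\<^bsub>M\<^esub> x = (\<ominus>\<^bsub>A\<^esub> \<one>\<^bsub>A\<^esub>) \<odot>\<^bsub>M\<^esub> x"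
      by (simp add: ract_minus_left ract_one)
    then show ?thesis using R that by auto
  qed
  with R show ?L
    by (auto intro!: submodule.intro subgroup.intro submodule_axioms.intro simp: a_inv_def)
qed

lemma submodule_diff:
  assumes "submodule N A M" "x \<in> N" "y \<in> N"
  shows "x \<ominus>\<^bsub>M\<^esub> y \<in> N"
proof -
  interpret N: submodule N A M by fact
  show ?thesis
    using N.m_closed[OF assms(2) N.m_inv_closed[OF assms(3)]]
    by (simp add: M.minus_eq a_inv_def)
qed

lemma right_module_restr:
  fixes H
  assumes "submodule H A M"
  shows "right_module A (M\<lparr>carrier := H\<rparr>)"
proof -
  note H = assms[unfolded submodule_iff]
  have sub: "x \<in> carrier M" if "x \<in> H" for x
    using that H by auto
  have "abelian_group (M\<lparr>carrier := H\<rparr>)"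
  proof (rule abelian_groupI; simp)
    fix x assume x: "x \<in> H"
    then have "\<zero>\<^bsub>M\<^esub> \<ominus>\<^bsub>M\<^esub> x \<in> H"
      using H by (intro submodule_diff assms) auto
    then show "\<exists>y\<in>H. y \<oplus>\<^bsub>M\<^esub> x = \<zero>\<^bsub>M\<^esub>"
      using sub[OF x] M.l_neg[of x] by (intro bexI[of _ "\<ominus>\<^bsub>M\<^esub> x"]) (auto simp: M.minus_eq)
  qed (use H in \<open>simp_all add: sub M.a_ac\<close>)
  then show ?thesis
    using H
    by (intro right_module.intro right_module_axioms.intro R.ring_axioms)
      (simp_all add: sub ract_add_ring ract_add_module ract_assoc ract_one)
qed

lemma submodule_cyclic:
  assumes "x \<in> carrier M"
  shows "submodule ((\<lambda>a. a \<odot>\<^bsub>M\<^esub> x) ` carrier A) A M"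
proof -
  have "\<exists>c\<in>carrier A. a \<odot>\<^bsub>M\<^esub> x \<oplus>\<^bsub>M\<^esub> b \<odot>\<^bsub>M\<^esub> x = c \<odot>\<^bsub>M\<^esub> x"
    if "a \<in> carrier A" "b \<in> carrier A" for a b
    using that assms by (intro bexI[of _ "a \<oplus>\<^bsub>A\<^esub> b"]) (auto simp: ract_add_ring)
  moreover have "\<exists>c\<in>carrier A. a \<odot>\<^bsub>M\<^esub> (b \<odot>\<^bsub>M\<^esub> x) = c \<odot>\<^bsub>M\<^esub> x"
    if "a \<in> carrier A" "b \<in> carrier A" for a b
    using that assms by (intro bexI[of _ "b \<otimes>\<^bsub>A\<^esub> a"]) (auto simp: ract_assoc)
  moreover have "\<exists>c\<in>carrier A. \<zero>\<^bsub>M\<^esub> = c \<odot>\<^bsub>M\<^esub> x"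
    using assms by (intro bexI[of _ "\<zero>\<^bsub>A\<^esub>"]) (auto simp: ract_zero_left)
  ultimately show ?thesis
    using assms ract_closed by (auto simp: submodule_iff image_iff)
qed

end

section \<open>Homomorphisms and transport of structure\<close>

lemma rmod_homD:
  assumes "f \<in> rmod_hom A M N"
  shows "\<And>x. x \<in> carrier M \<Longrightarrow> f x \<in> carrier N"
    and "\<And>x y. x \<in> carrier M \<Longrightarrow> y \<in> carrier M \<Longrightarrow> f (x \<oplus>\<^bsub>M\<^esub> y) = f x \<oplus>\<^bsub>N\<^esub> f y"
    and "\<And>a x. a \<in> carrier A \<Longrightarrow> x \<in> carrier M \<Longrightarrow> f (a \<odot>\<^bsub>M\<^esub> x) = a \<odot>\<^bsub>N\<^esub> f x"
  using assms by (auto simp: rmod_hom_def)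

lemma rmod_hom_zero:
  assumes "right_module A M" "right_module A N" "f \<in> rmod_hom A M N"
  shows "f \<zero>\<^bsub>M\<^esub> = \<zero>\<^bsub>N\<^esub>"
proof -
  interpret M: right_module A M by fact
  interpret N: right_module A N by fact
  have "f (\<zero>\<^bsub>A\<^esub> \<odot>\<^bsub>M\<^esub> \<zero>\<^bsub>M\<^esub>) = \<zero>\<^bsub>A\<^esub> \<odot>\<^bsub>N\<^esub> f \<zero>\<^bsub>M\<^esub>"
    using rmod_homD[OF assms(3)] by auto
  then show ?thesis
    using rmod_homD(1)[OF assms(3), of "\<zero>\<^bsub>M\<^esub>"] by (simp add: M.ract_zero_left N.ract_zero_left)
qed

lemma submodule_kernel:
  assumes "right_module A M" "right_module A N" "f \<in> rmod_hom A M N"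
  shows "submodule (a_kernel M N f) A M"
proof -
  interpret M: right_module A M by fact
  interpret N: right_module A N by fact
  show ?thesis
    using rmod_homD[OF assms(3)] rmod_hom_zero[OF assms] M.ract_closed
    by (auto simp: M.submodule_iff a_kernel_def' N.ract_zero_right)
qed

text \<open>Nothing is known about \<open>N\<close> in advance, so preservation of zero is a
  hypothesis and not a consequence of additivity. With the identity as \<open>f\<close>, the lemma
  also moves the axioms between records that agree on carrier, addition and zero but differ in other
  fields.\<close>

lemma abelian_group_image:
  assumes "abelian_group M"
    and add: "\<And>x y. x \<in> carrier M \<Longrightarrow> y \<in> carrier M \<Longrightarrow> f (x \<oplus>\<^bsub>M\<^esub> y) = f x \<oplus>\<^bsub>N\<^esub> f y"
    and zero: "f \<zero>\<^bsub>M\<^esub> = \<zero>\<^bsub>N\<^esub>" and surj: "f ` carrier M = carrier N"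
  shows "abelian_group N"
proof -
  interpret M: abelian_group M by fact
  have mem: "f x \<in> carrier N" if "x \<in> carrier M" for x
    using that surj by auto
  have a: "\<exists>x\<in>carrier M. u = f x" if "u \<in> carrier N" for u
    using that surj by auto
  show ?thesis
  proof (rule abelian_groupI)
    fix u v w assume "u \<in> carrier N" "v \<in> carrier N" "w \<in> carrier N"
    then obtain x y z where "x \<in> carrier M" "y \<in> carrier M" "z \<in> carrier M"
      "u = f x" "v = f y" "w = f z" using a by metis
    then show "u \<oplus>\<^bsub>N\<^esub> v \<oplus>\<^bsub>N\<^esub> w = u \<oplus>\<^bsub>N\<^esub> (v \<oplus>\<^bsub>N\<^esub> w)"
      by (simp flip: add add: M.a_assoc)
  next
    fix u v assume "u \<in> carrier N" "v \<in> carrier N"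
    then obtain x y where "x \<in> carrier M" "y \<in> carrier M" "u = f x" "v = f y" using a by metis
    then show "u \<oplus>\<^bsub>N\<^esub> v \<in> carrier N" "u \<oplus>\<^bsub>N\<^esub> v = v \<oplus>\<^bsub>N\<^esub> u"
      by (auto simp flip: add simp: M.a_comm intro: mem)
  next
    fix u assume "u \<in> carrier N"
    then obtain x where x: "x \<in> carrier M" "u = f x" using a by metis
    then show "\<zero>\<^bsub>N\<^esub> \<oplus>\<^bsub>N\<^esub> u = u"
      by (simp flip: add zero)
    show "\<exists>v\<in>carrier N. v \<oplus>\<^bsub>N\<^esub> u = \<zero>\<^bsub>N\<^esub>"
      using x by (intro bexI[of _ "f (\<ominus>\<^bsub>M\<^esub> x)"]) (auto simp flip: add zero simp: M.l_neg intro: mem)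
  qed (use mem zero in force)
qed

lemma right_module_image:
  assumes "right_module A M" and hom: "f \<in> rmod_hom A M N"
    and zero: "f \<zero>\<^bsub>M\<^esub> = \<zero>\<^bsub>N\<^esub>" and surj: "f ` carrier M = carrier N"
  shows "right_module A N"
proof -
  interpret M: right_module A M by fact
  have N: "abelian_group N"
    by (rule abelian_group_image[of M f]) (use M.M.abelian_group_axioms rmod_homD[OF hom] zero surj in auto)
  have img: "\<exists>x\<in>carrier M. u = f x" if "u \<in> carrier N" for u
    using that surj by auto
  note homs = M.ract_closed rmod_homD(1)[OF hom]
    rmod_homD(2)[OF hom, symmetric] rmod_homD(3)[OF hom, symmetric]
  have "right_module_axioms A N"
  proof
    fix a u assume a: "a \<in> carrier A" and u: "u \<in> carrier N"
    then obtain x where x: "x \<in> carrier M" "u = f x" using img by blast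
    show "a \<odot>\<^bsub>N\<^esub> u \<in> carrier N"
      using a x by (simp add: homs)
    fix b assume b: "b \<in> carrier A"
    show "(a \<oplus>\<^bsub>A\<^esub> b) \<odot>\<^bsub>N\<^esub> u = a \<odot>\<^bsub>N\<^esub> u \<oplus>\<^bsub>N\<^esub> b \<odot>\<^bsub>N\<^esub> u"
      "(a \<otimes>\<^bsub>A\<^esub> b) \<odot>\<^bsub>N\<^esub> u = b \<odot>\<^bsub>N\<^esub> (a \<odot>\<^bsub>N\<^esub> u)"
      using a b x by (simp_all add: homs M.ract_add_ring M.ract_assoc)
  next
    fix a u v assume "a \<in> carrier A" "u \<in> carrier N" "v \<in> carrier N"
    then obtain x y where "a \<in> carrier A" "x \<in> carrier M" "y \<in> carrier M" "u = f x" "v = f y"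
      using img by metis
    then show "a \<odot>\<^bsub>N\<^esub> (u \<oplus>\<^bsub>N\<^esub> v) = a \<odot>\<^bsub>N\<^esub> u \<oplus>\<^bsub>N\<^esub> a \<odot>\<^bsub>N\<^esub> v"
      by (simp add: homs M.ract_add_module)
  next
    fix u assume "u \<in> carrier N"
    then show "\<one>\<^bsub>A\<^esub> \<odot>\<^bsub>N\<^esub> u = u"
      using img[of u] by (auto simp: homs M.ract_one)
  qed
  then show ?thesis
    by (intro right_module.intro M.R.ring_axioms N)
qed

text \<open>One construction for two uses: an injective \<open>f\<close> gives an isomorphic copy in
  another type, and an \<open>f\<close> whose fibres form a congruence gives a quotient whose
  elements are the chosen codes. The operations are evaluated on preimages picked by
  \<open>inv_into\<close>.\<close>

definition image_module :: "('m \<Rightarrow> 'n) \<Rightarrow> ('a, 'm) module \<Rightarrow> ('a, 'n) module" where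
  "image_module f M =
    (let s = inv_into (carrier M) f in
     \<lparr>carrier = f ` carrier M,
      mult = (\<lambda>u v. f (s u \<otimes>\<^bsub>M\<^esub> s v)),
      one = f \<one>\<^bsub>M\<^esub>,
      zero = f \<zero>\<^bsub>M\<^esub>,
      add = (\<lambda>u v. f (s u \<oplus>\<^bsub>M\<^esub> s v)),
      smult = (\<lambda>a u. f (a \<odot>\<^bsub>M\<^esub> s u))\<rparr>)"

lemma image_module_simps:
  "carrier (image_module f M) = f ` carrier M"
  "\<one>\<^bsub>image_module f M\<^esub> = f \<one>\<^bsub>M\<^esub>"
  "\<zero>\<^bsub>image_module f M\<^esub> = f \<zero>\<^bsub>M\<^esub>"
  by (simp_all add: image_module_def Let_def)

text \<open>With the two conditions that follow: the fibres of \<open>f\<close> form a congruence,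
  so the arbitrary preimages in \<open>image_module\<close> do no harm.\<close>

definition add_compat :: "('a, 'm) module \<Rightarrow> ('m \<Rightarrow> 'n) \<Rightarrow> bool" where
  "add_compat M f \<longleftrightarrow> (\<forall>x\<in>carrier M. \<forall>x'\<in>carrier M. \<forall>y\<in>carrier M. \<forall>y'\<in>carrier M.
    f x = f x' \<longrightarrow> f y = f y' \<longrightarrow> f (x \<oplus>\<^bsub>M\<^esub> y) = f (x' \<oplus>\<^bsub>M\<^esub> y'))"

definition mult_compat :: "('a, 'm) module \<Rightarrow> ('m \<Rightarrow> 'n) \<Rightarrow> bool" where
  "mult_compat M f \<longleftrightarrow> (\<forall>x\<in>carrier M. \<forall>x'\<in>carrier M. \<forall>y\<in>carrier M. \<forall>y'\<in>carrier M.
    f x = f x' \<longrightarrow> f y = f y' \<longrightarrow> f (x \<otimes>\<^bsub>M\<^esub> y) = f (x' \<otimes>\<^bsub>M\<^esub> y'))"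

definition smult_compat :: "('a, 'c) ring_scheme \<Rightarrow> ('a, 'm) module \<Rightarrow> ('m \<Rightarrow> 'n) \<Rightarrow> bool" where
  "smult_compat A M f \<longleftrightarrow> (\<forall>a\<in>carrier A. \<forall>x\<in>carrier M. \<forall>x'\<in>carrier M.
    f x = f x' \<longrightarrow> f (a \<odot>\<^bsub>M\<^esub> x) = f (a \<odot>\<^bsub>M\<^esub> x'))"

lemma image_module_add:
  assumes "add_compat M f" "x \<in> carrier M" "y \<in> carrier M"
  shows "f x \<oplus>\<^bsub>image_module f M\<^esub> f y = f (x \<oplus>\<^bsub>M\<^esub> y)"
proof -
  let ?s = "inv_into (carrier M) f"
  have "f (?s (f x) \<oplus>\<^bsub>M\<^esub> ?s (f y)) = f (x \<oplus>\<^bsub>M\<^esub> y)"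
    using assms by (intro assms(1)[unfolded add_compat_def, rule_format])
      (auto intro: inv_into_into f_inv_into_f)
  then show ?thesis by (simp add: image_module_def Let_def)
qed

lemma image_module_mult:
  assumes "mult_compat M f" "x \<in> carrier M" "y \<in> carrier M"
  shows "f x \<otimes>\<^bsub>image_module f M\<^esub> f y = f (x \<otimes>\<^bsub>M\<^esub> y)"
proof -
  let ?s = "inv_into (carrier M) f"
  have "f (?s (f x) \<otimes>\<^bsub>M\<^esub> ?s (f y)) = f (x \<otimes>\<^bsub>M\<^esub> y)"
    using assms by (intro assms(1)[unfolded mult_compat_def, rule_format])
      (auto intro: inv_into_into f_inv_into_f)
  then show ?thesis by (simp add: image_module_def Let_def)
qed

lemma image_module_smult:
  assumes "smult_compat A M f" "a \<in> carrier A" "x \<in> carrier M"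
  shows "a \<odot>\<^bsub>image_module f M\<^esub> f x = f (a \<odot>\<^bsub>M\<^esub> x)"
proof -
  let ?s = "inv_into (carrier M) f"
  have "f (a \<odot>\<^bsub>M\<^esub> ?s (f x)) = f (a \<odot>\<^bsub>M\<^esub> x)"
    using assms by (intro assms(1)[unfolded smult_compat_def, rule_format])
      (auto intro: inv_into_into f_inv_into_f)
  then show ?thesis by (simp add: image_module_def Let_def)
qed

lemma image_module_hom:
  assumes "add_compat M f" "smult_compat A M f"
  shows "f \<in> rmod_hom A M (image_module f M)"
  using image_module_add[OF assms(1)] image_module_smult[OF assms(2)]
  by (auto simp: rmod_hom_def image_module_simps)

lemma right_module_image_module:
  assumes "right_module A M" "add_compat M f" "smult_compat A M f"
  shows "right_module A (image_module f M)"
  by (rule right_module_image[OF assms(1) image_module_hom[OF assms(2,3)]])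
    (auto simp: image_module_simps)

lemma compat_inj:
  assumes "inj f"
  shows "add_compat M f" "mult_compat M f" "smult_compat A M f"
  using assms by (auto simp: add_compat_def mult_compat_def smult_compat_def inj_eq)

text \<open>A submodule of \<open>N\<close> that contains the images of the generators has a
  preimage that contains the generators, hence is everything.\<close>

lemma fin_gen_image:
  assumes "right_module A M" "right_module A N" "f \<in> rmod_hom A M N" "f ` carrier M = carrier N"
    and "fin_gen A M"
  shows "fin_gen A N"
proof -
  interpret M: right_module A M by fact
  interpret N: right_module A N by fact
  note hom = rmod_homD[OF assms(3)]
  obtain G where G: "finite G" "G \<subseteq> carrier M"
    "\<And>K. submodule K A M \<Longrightarrow> G \<subseteq> K \<Longrightarrow> K = carrier M"
    using assms(5) unfolding fin_gen_def by blast
  have "K = carrier N" if K: "submodule K A N" "f ` G \<subseteq> K" for K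
  proof -
    have "submodule {x \<in> carrier M. f x \<in> K} A M"
      using K(1) hom rmod_hom_zero[OF assms(1-3)] M.ract_closed
      by (auto simp: M.submodule_iff N.submodule_iff)
    then have "{x \<in> carrier M. f x \<in> K} = carrier M"
      using G K(2) by (intro G(3)) auto
    then have "carrier N \<subseteq> K" unfolding assms(4)[symmetric] by blast
    then show ?thesis using K(1)[unfolded N.submodule_iff] by auto
  qed
  then show ?thesis
    unfolding fin_gen_def using G hom(1) by (intro exI[of _ "f ` G"]) auto
qed

lemma right_module_syzygy:
  assumes "syzygy A d X Y" "right_module A X"
  shows "right_module A Y"
  using assms
proof induction
  case (syzygy_Suc d X Y P p)
  then have "right_module A P" "p \<in> rmod_hom A P Y"
    by (auto simp: projective_cover_def fg_right_module_def)
  then show ?case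
    using syzygy_Suc unfolding restr_module_def
    by (intro right_module.right_module_restr submodule_kernel)
qed

lemma right_module_sum:
  assumes "right_module A M" "right_module A N"
  shows "right_module A (rmod_sum M N)"
proof -
  interpret M: right_module A M by fact
  interpret N: right_module A N by fact
  have "abelian_group (rmod_sum M N)"
  proof (rule abelian_groupI)
    fix x assume "x \<in> carrier (rmod_sum M N)"
    then show "\<exists>y\<in>carrier (rmod_sum M N). y \<oplus>\<^bsub>rmod_sum M N\<^esub> x = \<zero>\<^bsub>rmod_sum M N\<^esub>"
      by (intro bexI[of _ "(\<ominus>\<^bsub>M\<^esub> fst x, \<ominus>\<^bsub>N\<^esub> snd x)"]) (auto simp: rmod_sum_def M.M.l_neg N.M.l_neg)
  qed (auto simp: rmod_sum_def M.M.a_ac N.M.a_ac)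
  then show ?thesis
    by (intro right_module.intro right_module_axioms.intro M.R.ring_axioms)
      (auto simp: rmod_sum_def M.ract_closed M.ract_add_ring M.ract_add_module M.ract_assoc M.ract_one
        N.ract_closed N.ract_add_ring N.ract_add_module N.ract_assoc N.ract_one)
qed


section \<open>Corner algebras\<close>

text \<open>
  \<open>f = \<iota> 1\<close> is an idempotent of \<open>C\<close> with \<open>C f = f C f \<cong> A\<close>. Hence \<open>X \<mapsto> X f\<close> and inflation
  along \<open>\<pi>\<close> are exact functors that move projective covers, and so syzygies, from \<open>C\<close> to \<open>A\<close>.
\<close>

locale corner_ring = C: ring C + A: ring A
  for C :: "('a, 'c) ring_scheme" and A :: "('a, 'd) ring_scheme"
    and \<pi> :: "'a \<Rightarrow> 'a" and \<iota> :: "'a \<Rightarrow> 'a" +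
  assumes pi_hom: "\<pi> \<in> ring_hom C A"
    and iota_closed: "\<And>a. a \<in> carrier A \<Longrightarrow> \<iota> a \<in> carrier C"
    and pi_iota: "\<And>a. a \<in> carrier A \<Longrightarrow> \<pi> (\<iota> a) = a"
    and mult_idem: "\<And>c. c \<in> carrier C \<Longrightarrow> c \<otimes>\<^bsub>C\<^esub> \<iota> \<one>\<^bsub>A\<^esub> = \<iota> (\<pi> c)"
begin

abbreviation idem :: 'a where "idem \<equiv> \<iota> \<one>\<^bsub>A\<^esub>"

lemma pi_closed: "c \<in> carrier C \<Longrightarrow> \<pi> c \<in> carrier A"
  using pi_hom by (auto simp: ring_hom_def)

lemma idem_closed: "idem \<in> carrier C"
  by (simp add: iota_closed)

lemma iota_idem: "a \<in> carrier A \<Longrightarrow> \<iota> a \<otimes>\<^bsub>C\<^esub> idem = \<iota> a"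
  by (simp add: mult_idem iota_closed pi_iota)

text \<open>By \<open>mult_idem\<close>, an element fixed by right multiplication with
  \<open>idem\<close> is recovered from its value under \<open>\<pi>\<close>. Sums and products of
  values of \<open>\<iota>\<close> are fixed in this way, so the homomorphism property of
  \<open>\<pi>\<close> passes to \<open>\<iota>\<close>.\<close>

lemma iota_add:
  assumes "a \<in> carrier A" "b \<in> carrier A"
  shows "\<iota> (a \<oplus>\<^bsub>A\<^esub> b) = \<iota> a \<oplus>\<^bsub>C\<^esub> \<iota> b"
proof -
  have "\<iota> a \<oplus>\<^bsub>C\<^esub> \<iota> b = (\<iota> a \<oplus>\<^bsub>C\<^esub> \<iota> b) \<otimes>\<^bsub>C\<^esub> idem"
    using assms by (simp add: C.l_distr iota_closed iota_idem)
  also have "\<dots> = \<iota> (\<pi> (\<iota> a \<oplus>\<^bsub>C\<^esub> \<iota> b))"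
    using assms by (simp add: mult_idem iota_closed)
  finally show ?thesis
    using assms pi_hom by (simp add: ring_hom_add iota_closed pi_iota)
qed

lemma iota_mult:
  assumes "a \<in> carrier A" "b \<in> carrier A"
  shows "\<iota> (a \<otimes>\<^bsub>A\<^esub> b) = \<iota> a \<otimes>\<^bsub>C\<^esub> \<iota> b"
proof -
  have "\<iota> a \<otimes>\<^bsub>C\<^esub> \<iota> b = (\<iota> a \<otimes>\<^bsub>C\<^esub> \<iota> b) \<otimes>\<^bsub>C\<^esub> idem"
    using assms by (simp add: C.m_assoc iota_closed iota_idem)
  also have "\<dots> = \<iota> (\<pi> (\<iota> a \<otimes>\<^bsub>C\<^esub> \<iota> b))"
    using assms by (simp add: mult_idem iota_closed)
  finally show ?thesis
    using assms pi_hom by (simp add: ring_hom_mult iota_closed pi_iota)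
qed

lemma idem_iota: "a \<in> carrier A \<Longrightarrow> idem \<otimes>\<^bsub>C\<^esub> \<iota> a = \<iota> a"
  using iota_mult[of "\<one>\<^bsub>A\<^esub>" a] by simp

text \<open>This is where \<open>C f = f C f\<close> pays off: it makes
  \<open>x \<mapsto> x f\<close> a homomorphism from \<open>X\<close> to the inflation of its
  corner, the unit of an adjunction with the corner functor on the left.\<close>

lemma idem_ract:
  assumes "right_module C X" "c \<in> carrier C" "x \<in> carrier X"
  shows "idem \<odot>\<^bsub>X\<^esub> (c \<odot>\<^bsub>X\<^esub> x) = \<iota> (\<pi> c) \<odot>\<^bsub>X\<^esub> (idem \<odot>\<^bsub>X\<^esub> x)"
proof -
  interpret X: right_module C X by fact
  have "idem \<odot>\<^bsub>X\<^esub> (c \<odot>\<^bsub>X\<^esub> x) = (c \<otimes>\<^bsub>C\<^esub> idem) \<odot>\<^bsub>X\<^esub> x"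
    using assms by (simp add: X.ract_assoc idem_closed)
  also have "\<dots> = (idem \<otimes>\<^bsub>C\<^esub> \<iota> (\<pi> c)) \<odot>\<^bsub>X\<^esub> x"
    using assms by (simp add: mult_idem idem_iota pi_closed)
  finally show ?thesis
    using assms by (simp add: X.ract_assoc idem_closed iota_closed pi_closed)
qed

text \<open>
  A relation, because \<open>X\<close> need not be equal to the corner of its inflation: the values of
  \<^const>\<open>smult\<close> at scalars outside the carrier may differ.
\<close>

definition corner_of :: "('a, 'm) module \<Rightarrow> ('a, 'm) module \<Rightarrow> bool" where
  "corner_of X' X \<longleftrightarrow>
    carrier X' = {x \<in> carrier X. idem \<odot>\<^bsub>X\<^esub> x = x} \<and> \<zero>\<^bsub>X'\<^esub> = \<zero>\<^bsub>X\<^esub> \<and>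
    (\<forall>x\<in>carrier X'. \<forall>y\<in>carrier X'. x \<oplus>\<^bsub>X'\<^esub> y = x \<oplus>\<^bsub>X\<^esub> y) \<and>
    (\<forall>a\<in>carrier A. \<forall>x\<in>carrier X'. a \<odot>\<^bsub>X'\<^esub> x = \<iota> a \<odot>\<^bsub>X\<^esub> x)"

definition corner :: "('a, 'm) module \<Rightarrow> ('a, 'm) module" where
  "corner X = X\<lparr>carrier := {x \<in> carrier X. idem \<odot>\<^bsub>X\<^esub> x = x}, smult := \<lambda>a x. \<iota> a \<odot>\<^bsub>X\<^esub> x\<rparr>"

definition inflation :: "('a, 'm) module \<Rightarrow> ('a, 'm) module" where
  "inflation X = X\<lparr>smult := \<lambda>c x. \<pi> c \<odot>\<^bsub>X\<^esub> x\<rparr>"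

lemma corner_of_corner: "corner_of (corner X) X"
  by (simp add: corner_of_def corner_def)

lemma right_module_inflation:
  assumes "right_module A X"
  shows "right_module C (inflation X)"
proof -
  interpret X: right_module A X by fact
  have "abelian_group (inflation X)"
    by (rule abelian_group_image[of X "\<lambda>x. x"])
      (auto simp: inflation_def X.M.abelian_group_axioms)
  then show ?thesis
    using pi_hom
    by (intro right_module.intro right_module_axioms.intro C.ring_axioms)
      (simp_all add: inflation_def ring_hom_add ring_hom_mult ring_hom_one pi_closed X.ract_closed
        X.ract_add_ring X.ract_add_module X.ract_assoc X.ract_one)
qed

lemma corner_of_inflation:
  assumes "right_module A X"
  shows "corner_of X (inflation X)"
proof -
  interpret X: right_module A X by fact
  show ?thesis
    by (auto simp: corner_of_def inflation_def pi_iota X.ract_one)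
qed

lemma hom_inflation:
  assumes "f \<in> rmod_hom A X Y"
  shows "f \<in> rmod_hom C (inflation X) (inflation Y)"
  using assms by (auto simp: rmod_hom_def inflation_def pi_closed)

text \<open>Since \<open>\<pi>\<close> is surjective by \<open>pi_iota\<close>, a submodule of the
  inflation is already closed under the action of \<open>A\<close>.\<close>

lemma simple_inflation:
  assumes "simple_right_module A X"
  shows "simple_right_module C (inflation X)"
proof -
  interpret X: right_module A X using assms by (simp add: simple_right_module_def)
  interpret I: right_module C "inflation X" by (rule right_module_inflation) unfold_locales
  have "submodule N A X" if "submodule N C (inflation X)" for N
    using that unfolding X.submodule_iff I.submodule_iff
    by (auto simp: inflation_def) (metis iota_closed pi_iota)
  moreover have "carrier (inflation X) = carrier X" "\<zero>\<^bsub>inflation X\<^esub> = \<zero>\<^bsub>X\<^esub>"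
    by (simp_all add: inflation_def)
  ultimately show ?thesis
    using assms I.right_module_axioms by (simp add: simple_right_module_def)
qed

end

section \<open>The corner of a single module\<close>

locale corner_module = corner_ring C A \<pi> \<iota> + X: right_module C X
  for C :: "('a, 'c) ring_scheme" and A :: "('a, 'd) ring_scheme"
    and \<pi> :: "'a \<Rightarrow> 'a" and \<iota> :: "'a \<Rightarrow> 'a"
    and X :: "('a, 'm) module" and X' :: "('a, 'm) module" +
  assumes corner_of: "corner_of X' X"
begin

lemma mem_corner: "x \<in> carrier X' \<longleftrightarrow> x \<in> carrier X \<and> idem \<odot>\<^bsub>X\<^esub> x = x"
  using corner_of by (auto simp: corner_of_def)

lemma corner_zero: "\<zero>\<^bsub>X'\<^esub> = \<zero>\<^bsub>X\<^esub>"
  using corner_of by (auto simp: corner_of_def)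

lemma corner_add: "x \<in> carrier X' \<Longrightarrow> y \<in> carrier X' \<Longrightarrow> x \<oplus>\<^bsub>X'\<^esub> y = x \<oplus>\<^bsub>X\<^esub> y"
  using corner_of by (auto simp: corner_of_def)

lemma corner_smult: "a \<in> carrier A \<Longrightarrow> x \<in> carrier X' \<Longrightarrow> a \<odot>\<^bsub>X'\<^esub> x = \<iota> a \<odot>\<^bsub>X\<^esub> x"
  using corner_of by (auto simp: corner_of_def)

lemma iota_ract_mem:
  assumes "a \<in> carrier A" "x \<in> carrier X"
  shows "\<iota> a \<odot>\<^bsub>X\<^esub> x \<in> carrier X'"
proof -
  have "idem \<odot>\<^bsub>X\<^esub> (\<iota> a \<odot>\<^bsub>X\<^esub> x) = (\<iota> a \<otimes>\<^bsub>C\<^esub> idem) \<odot>\<^bsub>X\<^esub> x"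
    using assms by (simp add: X.ract_assoc idem_closed iota_closed)
  then show ?thesis
    using assms by (simp add: mem_corner X.ract_closed iota_closed iota_idem)
qed

lemma idem_ract_mem: "x \<in> carrier X \<Longrightarrow> idem \<odot>\<^bsub>X\<^esub> x \<in> carrier X'"
  by (simp add: iota_ract_mem)

lemma idem_ract_corner:
  assumes "c \<in> carrier C" "x \<in> carrier X"
  shows "idem \<odot>\<^bsub>X\<^esub> (c \<odot>\<^bsub>X\<^esub> x) = \<pi> c \<odot>\<^bsub>X'\<^esub> (idem \<odot>\<^bsub>X\<^esub> x)"
  using assms by (simp add: idem_ract[OF X.right_module_axioms] corner_smult idem_ract_mem pi_closed)

lemma right_module_corner: "right_module A X'"
proof -
  have closed: "x \<oplus>\<^bsub>X\<^esub> y \<in> carrier X'" if "x \<in> carrier X'" "y \<in> carrier X'" for x y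
    using that by (simp add: mem_corner X.ract_add_module idem_closed)
  have zero: "\<zero>\<^bsub>X\<^esub> \<in> carrier X'"
    by (simp add: mem_corner X.ract_zero_right idem_closed)
  have minus: "\<ominus>\<^bsub>X\<^esub> x \<in> carrier X'" if "x \<in> carrier X'" for x
    using that by (simp add: mem_corner X.ract_minus_right idem_closed)
  have sub: "x \<in> carrier X" if "x \<in> carrier X'" for x
    using that by (simp add: mem_corner)
  have "abelian_group X'"
  proof (rule abelian_groupI)
    fix x assume x: "x \<in> carrier X'"
    then show "\<exists>y\<in>carrier X'. y \<oplus>\<^bsub>X'\<^esub> x = \<zero>\<^bsub>X'\<^esub>"
      using minus[OF x] sub[OF x] X.M.l_neg[of x]
      by (intro bexI[of _ "\<ominus>\<^bsub>X\<^esub> x"]) (auto simp: corner_add corner_zero)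
  qed (simp_all add: corner_add corner_zero closed zero sub X.M.a_ac)
  moreover have "\<one>\<^bsub>A\<^esub> \<odot>\<^bsub>X'\<^esub> x = x" if "x \<in> carrier X'" for x
    using that by (simp add: corner_smult mem_corner)
  ultimately show ?thesis
    by (intro right_module.intro right_module_axioms.intro A.ring_axioms)
      (simp_all add: corner_add corner_smult iota_ract_mem sub closed iota_add iota_mult iota_closed
        X.ract_add_ring X.ract_add_module X.ract_assoc)
qed

sublocale X': right_module A X'
  by (rule right_module_corner)

text \<open>Closed under the action because \<open>(x c) f = (x f) \<pi>(c)\<close>. Pulling back
  turns questions on generation in the corner into questions on generation in
  \<open>X\<close>.\<close>

lemma submodule_pullback:
  assumes "submodule N A X'"
  shows "submodule {x \<in> carrier X. idem \<odot>\<^bsub>X\<^esub> x \<in> N} C X"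
  using assms[unfolded X'.submodule_iff]
  by (auto simp: X.submodule_iff X.ract_closed X.ract_add_module X.ract_zero_right idem_closed
      idem_ract_corner corner_zero pi_closed subset_iff simp flip: corner_add)

lemma pullback_full:
  assumes "submodule N A X'" "{x \<in> carrier X. idem \<odot>\<^bsub>X\<^esub> x \<in> N} = carrier X"
  shows "N = carrier X'"
proof
  show "N \<subseteq> carrier X'" using assms(1) by (simp add: X'.submodule_iff)
  show "carrier X' \<subseteq> N"
  proof
    fix x assume "x \<in> carrier X'"
    then have "x \<in> carrier X" "idem \<odot>\<^bsub>X\<^esub> x = x" by (auto simp: mem_corner)
    then have "x \<in> {x \<in> carrier X. idem \<odot>\<^bsub>X\<^esub> x \<in> N}" using assms(2) by simp
    with \<open>idem \<odot>\<^bsub>X\<^esub> x = x\<close> show "x \<in> N" by simp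
  qed
qed

lemma submodule_corner:
  assumes "submodule N C X"
  shows "submodule (N \<inter> carrier X') A X'"
  using assms[unfolded X.submodule_iff] X'.ract_closed X'.M.a_closed X'.M.zero_closed
  by (auto simp: X'.submodule_iff corner_zero corner_add corner_smult iota_closed)

lemma idem_ract_submodule:
  assumes "submodule N C X" "x \<in> N"
  shows "idem \<odot>\<^bsub>X\<^esub> x \<in> N \<inter> carrier X'"
  using assms idem_closed by (auto simp: X.submodule_iff intro: idem_ract_mem)

lemma fin_gen_corner:
  assumes "fin_gen C X"
  shows "fin_gen A X'"
proof -
  obtain G where G: "finite G" "G \<subseteq> carrier X"
    "\<And>N. submodule N C X \<Longrightarrow> G \<subseteq> N \<Longrightarrow> N = carrier X"
    using assms unfolding fin_gen_def by blast
  have "N = carrier X'" if "submodule N A X'" "(\<lambda>x. idem \<odot>\<^bsub>X\<^esub> x) ` G \<subseteq> N" for N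
    by (rule pullback_full[OF that(1) G(3)[OF submodule_pullback[OF that(1)]]]) (use G that in auto)
  then show ?thesis
    unfolding fin_gen_def using G idem_ract_mem
    by (intro exI[of _ "(\<lambda>x. idem \<odot>\<^bsub>X\<^esub> x) ` G"]) auto
qed

text \<open>If \<open>K f + N\<close> is the whole corner, then \<open>K\<close> and the pullback of
  \<open>N\<close> span \<open>X\<close>: write \<open>x f = k + n\<close> with \<open>k\<close> in
  \<open>K\<close> and in the corner; then \<open>(x - k) f = n\<close>, so \<open>x - k\<close>
  lies in the pullback.\<close>

lemma superfluous_corner:
  assumes "superfluous C X K"
  shows "superfluous A X' (K \<inter> carrier X')"
proof -
  have K: "submodule K C X" using assms by (simp add: superfluous_def)
  have "N = carrier X'" if N: "submodule N A X'" "(K \<inter> carrier X') <+>\<^bsub>X'\<^esub> N = carrier X'" for N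
  proof (rule pullback_full[OF N(1)])
    let ?N = "{x \<in> carrier X. idem \<odot>\<^bsub>X\<^esub> x \<in> N}"
    note sub = submodule_pullback[OF N(1)]
    have "K <+>\<^bsub>X\<^esub> ?N = carrier X"
    proof
      show "K <+>\<^bsub>X\<^esub> ?N \<subseteq> carrier X"
        using K by (auto simp: set_add_def' X.submodule_iff)
      show "carrier X \<subseteq> K <+>\<^bsub>X\<^esub> ?N"
      proof
        fix x assume x: "x \<in> carrier X"
        then have "idem \<odot>\<^bsub>X\<^esub> x \<in> (K \<inter> carrier X') <+>\<^bsub>X'\<^esub> N"
          using idem_ract_mem N(2) by simp
        then obtain k n where kn: "k \<in> K" "k \<in> carrier X'" "n \<in> N"
          "idem \<odot>\<^bsub>X\<^esub> x = k \<oplus>\<^bsub>X'\<^esub> n"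
          by (auto simp: set_add_def')
        have n: "n \<in> carrier X'" using kn(3) N(1) by (auto simp: X'.submodule_iff)
        have c: "k \<in> carrier X" "n \<in> carrier X" "idem \<odot>\<^bsub>X\<^esub> k = k"
          using kn n by (auto simp: mem_corner)
        have "idem \<odot>\<^bsub>X\<^esub> (x \<ominus>\<^bsub>X\<^esub> k) = (k \<oplus>\<^bsub>X\<^esub> n) \<ominus>\<^bsub>X\<^esub> k"
          using x c kn n by (simp add: X.ract_diff_right idem_closed corner_add)
        also have "\<dots> = n"
          using c by (simp add: X.M.minus_eq X.M.a_comm[of k n] X.M.a_assoc X.M.r_neg)
        finally have "x \<ominus>\<^bsub>X\<^esub> k \<in> ?N" using x c kn by simp
        moreover have "x = k \<oplus>\<^bsub>X\<^esub> (x \<ominus>\<^bsub>X\<^esub> k)"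
          using c x by (simp add: X.M.add_diff_cancel)
        ultimately show "x \<in> K <+>\<^bsub>X\<^esub> ?N"
          using kn(1) by (auto simp: set_add_def')
      qed
    qed
    then show "?N = carrier X"
      using assms sub by (simp add: superfluous_def)
  qed
  then show ?thesis
    using submodule_corner[OF K] by (simp add: superfluous_def)
qed

end

section \<open>The corner functor on projective covers, syzygies and summands\<close>

context corner_ring
begin

lemma corner_moduleI: "right_module C X \<Longrightarrow> corner_of X' X \<Longrightarrow> corner_module C A \<pi> \<iota> X X'"
  by (intro corner_module.intro corner_module_axioms.intro corner_ring_axioms)

lemma hom_corner:
  assumes "right_module C X" "corner_of X' X" "right_module C Y" "corner_of Y' Y"
    and f: "f \<in> rmod_hom C X Y"
  shows "f \<in> rmod_hom A X' Y'"
proof -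
  interpret X: corner_module C A \<pi> \<iota> X X' using assms by (intro corner_moduleI)
  interpret Y: corner_module C A \<pi> \<iota> Y Y' using assms by (intro corner_moduleI)
  note f = rmod_homD[OF f]
  have "f x \<in> carrier Y'" if "x \<in> carrier X'" for x
    using that f(1)[of x] f(3)[OF idem_closed, of x] by (simp add: X.mem_corner Y.mem_corner)
  moreover have "x \<in> carrier X" if "x \<in> carrier X'" for x
    using that by (simp add: X.mem_corner)
  ultimately show ?thesis
    using f by (auto simp: rmod_hom_def X.corner_add Y.corner_add X.corner_smult Y.corner_smult
        iota_closed)
qed

text \<open>A preimage \<open>x\<close> of an element fixed by the idempotent may be replaced by
  \<open>x f\<close>, which lies in the corner.\<close>

lemma hom_corner_surj:
  assumes "right_module C X" "corner_of X' X" "right_module C Y" "corner_of Y' Y"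
    and f: "f \<in> rmod_hom C X Y" and surj: "f ` carrier X = carrier Y"
  shows "f ` carrier X' = carrier Y'"
proof
  interpret X: corner_module C A \<pi> \<iota> X X' using assms by (intro corner_moduleI)
  interpret Y: corner_module C A \<pi> \<iota> Y Y' using assms by (intro corner_moduleI)
  show "f ` carrier X' \<subseteq> carrier Y'"
    using rmod_homD(1)[OF hom_corner[OF assms(1-5)]] by auto
  show "carrier Y' \<subseteq> f ` carrier X'"
  proof
    fix y assume y: "y \<in> carrier Y'"
    then obtain x where x: "x \<in> carrier X" "y = f x"
      using surj by (auto simp: Y.mem_corner)
    then have "y = f (idem \<odot>\<^bsub>X\<^esub> x)"
      using y rmod_homD(3)[OF f idem_closed x(1)] by (simp add: Y.mem_corner)
    then show "y \<in> f ` carrier X'" using X.idem_ract_mem[OF x(1)] by blast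
  qed
qed

text \<open>The corner functor is left adjoint to inflation, and inflation preserves surjections;
  such a left adjoint preserves projectives.\<close>

lemma projective_corner:
  assumes P: "projective_rmod C P" and cor: "corner_of P' P"
  shows "projective_rmod A P'"
  unfolding projective_rmod_def
proof (intro conjI allI impI; (elim conjE)?)
  have rm: "right_module C P" using P by (simp add: projective_rmod_def)
  interpret P: corner_module C A \<pi> \<iota> P P' using rm cor by (intro corner_moduleI)
  show "right_module A P'" by (rule P.right_module_corner)
  fix N N' :: "'a rmod" and g f
  assume N: "right_module A N" and N': "right_module A N'" and g: "g \<in> rmod_hom A N N'"
    and surj: "g ` carrier N = carrier N'" and f: "f \<in> rmod_hom A P' N'"
  \<comment> \<open>The adjoint of \<open>f\<close>, defined on all of \<open>P\<close>. A lift
    \<open>h\<close> of it, restricted to the corner, lifts \<open>f\<close>, because corner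
    elements are fixed by the idempotent.\<close>
  let ?f = "\<lambda>x. f (idem \<odot>\<^bsub>P\<^esub> x)"
  have hf: "?f \<in> rmod_hom C P (inflation N')"
    using rmod_homD[OF f] P.idem_ract_mem
    by (auto simp: rmod_hom_def inflation_def P.X.ract_add_module idem_closed P.idem_ract_corner
        pi_closed simp flip: P.corner_add)
  have surj': "g ` carrier (inflation N) = carrier (inflation N')"
    using surj by (simp add: inflation_def)
  obtain h where h: "h \<in> rmod_hom C P (inflation N)" "\<forall>x\<in>carrier P. g (h x) = ?f x"
    using P[unfolded projective_rmod_def, THEN conjunct2, rule_format,
        of "inflation N" "inflation N'" g ?f] right_module_inflation[OF N]
      right_module_inflation[OF N'] hom_inflation[OF g] surj' hf
    by blast
  have "h \<in> rmod_hom A P' N"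
    by (rule hom_corner[OF rm cor right_module_inflation[OF N] corner_of_inflation[OF N] h(1)])
  moreover have "\<forall>x\<in>carrier P'. g (h x) = f x"
    using h(2) by (auto simp: P.mem_corner)
  ultimately show "\<exists>h\<in>rmod_hom A P' N. \<forall>x\<in>carrier P'. g (h x) = f x" by blast
qed

lemma kernel_corner:
  assumes "right_module C P" "corner_of P' P" "right_module C Y" "corner_of Y' Y"
  shows "a_kernel P' Y' p = a_kernel P Y p \<inter> carrier P'"
proof -
  interpret P: corner_module C A \<pi> \<iota> P P' using assms by (intro corner_moduleI)
  interpret Y: corner_module C A \<pi> \<iota> Y Y' using assms by (intro corner_moduleI)
  show ?thesis by (auto simp: a_kernel_def' Y.corner_zero P.mem_corner)
qed

lemma corner_of_restr:
  assumes "corner_of P' P" "K \<subseteq> carrier P"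
  shows "corner_of (restr_module P' (K \<inter> carrier P')) (restr_module P K)"
  using assms by (auto simp: corner_of_def restr_module_def)

lemma projective_cover_corner:
  assumes "projective_cover C P p Y" "right_module C Y" "corner_of P' P" "corner_of Y' Y"
  shows "projective_cover A P' p Y'"
proof -
  have P: "right_module C P"
    using assms by (simp add: projective_cover_def fg_right_module_def)
  interpret P: corner_module C A \<pi> \<iota> P P' using P assms by (intro corner_moduleI)
  show ?thesis
    using assms P hom_corner[OF P assms(3,2,4)] hom_corner_surj[OF P assms(3,2,4)]
      kernel_corner[OF P assms(3,2,4)]
    by (auto simp: projective_cover_def fg_right_module_def P.right_module_corner
        intro: P.fin_gen_corner projective_corner P.superfluous_corner)
qed

text \<open>The covering maps remain the same functions, restricted to corners, and the corner of a
  kernel is the kernel of the restriction. The result is existential because both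
  \<open>syzygy\<close> and \<open>corner_of\<close> are relations.\<close>

lemma syzygy_corner:
  assumes "syzygy C d X Y" "right_module C X" "corner_of X' X"
  shows "\<exists>Y'. syzygy A d X' Y' \<and> corner_of Y' Y"
  using assms
proof induction
  case (syzygy_0 X)
  then show ?case using syzygy.syzygy_0 by blast
next
  case (syzygy_Suc d X Y P p)
  then obtain Y' where Y': "syzygy A d X' Y'" "corner_of Y' Y" by blast
  have Y: "right_module C Y" using right_module_syzygy syzygy_Suc by blast
  have P: "right_module C P"
    using syzygy_Suc by (simp add: projective_cover_def fg_right_module_def)
  let ?P' = "corner P"
  note cor = corner_of_corner[of P]
  have "syzygy A (Suc d) X' (restr_module ?P' (a_kernel ?P' Y' p))"
    by (rule syzygy.syzygy_Suc[OF Y'(1) projective_cover_corner[OF syzygy_Suc.hyps(2) Y cor Y'(2)]])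
  moreover have "corner_of (restr_module ?P' (a_kernel ?P' Y' p)) (restr_module P (a_kernel P Y p))"
    unfolding kernel_corner[OF P cor Y Y'(2)]
    by (rule corner_of_restr[OF cor]) (auto simp: a_kernel_def')
  ultimately show ?case by blast
qed

lemma corner_of_sum:
  assumes "corner_of M' M" "corner_of N' N"
  shows "corner_of (rmod_sum M' N') (rmod_sum M N)"
  using assms by (auto simp: corner_of_def rmod_sum_def)

text \<open>The idempotent acts within each of \<open>U\<close> and \<open>V\<close>, so applying it
  to \<open>y = u + v\<close> decomposes a corner element inside the corner; the isomorphism
  restricts.\<close>

lemma iso_direct_summand_corner:
  assumes X: "right_module C X" "corner_of X' X" and Y: "right_module C Y" "corner_of Y' Y"
    and "iso_direct_summand C X Y"
  shows "iso_direct_summand A X' Y'"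
proof -
  interpret X: corner_module C A \<pi> \<iota> X X' using X by (intro corner_moduleI)
  interpret Y: corner_module C A \<pi> \<iota> Y Y' using Y by (intro corner_moduleI)
  obtain U V f where U: "submodule U C Y" and V: "submodule V C Y"
    and sum: "U <+>\<^bsub>Y\<^esub> V = carrier Y" and int: "U \<inter> V = {\<zero>\<^bsub>Y\<^esub>}"
    and f: "f \<in> rmod_hom C X (restr_module Y U)" "bij_betw f (carrier X) U"
    using assms(5) unfolding iso_direct_summand_def rmod_isomorphic_def
    by (auto simp: restr_module_def)
  let ?U = "U \<inter> carrier Y'" and ?V = "V \<inter> carrier Y'"
  have UY: "U \<subseteq> carrier Y" and VY: "V \<subseteq> carrier Y"
    using U V by (auto simp: Y.X.submodule_iff)
  have rU: "right_module C (restr_module Y U)"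
    unfolding restr_module_def by (rule Y.X.right_module_restr[OF U])
  note cU = corner_of_restr[OF Y(2) UY]
  have "?U <+>\<^bsub>Y'\<^esub> ?V = carrier Y'"
  proof
    show "?U <+>\<^bsub>Y'\<^esub> ?V \<subseteq> carrier Y'"
      by (auto simp: set_add_def')
    show "carrier Y' \<subseteq> ?U <+>\<^bsub>Y'\<^esub> ?V"
    proof
      fix y assume "y \<in> carrier Y'"
      then have y: "y \<in> carrier Y" "idem \<odot>\<^bsub>Y\<^esub> y = y" by (auto simp: Y.mem_corner)
      then have "y \<in> U <+>\<^bsub>Y\<^esub> V" using sum by simp
      then obtain u v where uv: "u \<in> U" "v \<in> V" "y = u \<oplus>\<^bsub>Y\<^esub> v"
        by (auto simp: set_add_def')
      note m = Y.idem_ract_submodule[OF U uv(1)] Y.idem_ract_submodule[OF V uv(2)]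
      have "y = idem \<odot>\<^bsub>Y\<^esub> u \<oplus>\<^bsub>Y'\<^esub> idem \<odot>\<^bsub>Y\<^esub> v"
        using y uv UY VY m by (auto simp: Y.X.ract_add_module idem_closed Y.corner_add subset_iff)
      then show "y \<in> ?U <+>\<^bsub>Y'\<^esub> ?V"
        using m by (auto simp: set_add_def')
    qed
  qed
  moreover have "?U \<inter> ?V = {\<zero>\<^bsub>Y'\<^esub>}"
    using int Y.X'.M.zero_closed by (auto simp: Y.corner_zero)
  moreover have "rmod_isomorphic A X' (restr_module Y' ?U)"
    unfolding rmod_isomorphic_def
  proof (intro bexI)
    show "f \<in> rmod_hom A X' (restr_module Y' ?U)"
      by (rule hom_corner[OF X rU cU f(1)])
    have "inj_on f (carrier X')"
      using f(2) by (auto simp: bij_betw_def X.mem_corner intro: inj_on_subset)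
    moreover have "f ` carrier X' = carrier (restr_module Y' ?U)"
      using f(2) by (intro hom_corner_surj[OF X rU cU f(1)]) (simp add: bij_betw_def restr_module_def)
    ultimately show "bij_betw f (carrier X') (carrier (restr_module Y' ?U))"
      by (simp add: bij_betw_def)
  qed
  ultimately show ?thesis
    unfolding iso_direct_summand_def
    using Y.submodule_corner[OF U] Y.submodule_corner[OF V] by blast
qed

lemma deloops_at_corner:
  assumes "deloops_at C X d" "right_module C X" "corner_of X' X"
  shows "deloops_at A X' d"
proof -
  obtain K P M L where K: "syzygy C d X K" and P: "fg_right_module C P" "projective_rmod C P"
    and M: "fg_right_module C M" and L: "syzygy C (d + 1) M L"
    and summand: "iso_direct_summand C K (rmod_sum P L)"
    using assms(1) unfolding deloops_at_def by blast
  have rP: "right_module C P" and rM: "right_module C M"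
    using P M by (auto simp: fg_right_module_def)
  have rK: "right_module C K" and rL: "right_module C L"
    using right_module_syzygy K L assms(2) rM by blast+
  interpret P: corner_module C A \<pi> \<iota> P "corner P"
    by (intro corner_moduleI rP corner_of_corner)
  interpret M: corner_module C A \<pi> \<iota> M "corner M"
    by (intro corner_moduleI rM corner_of_corner)
  obtain K' where K': "syzygy A d X' K'" "corner_of K' K"
    using syzygy_corner K assms(2,3) by blast
  obtain L' where L': "syzygy A (d + 1) (corner M) L'" "corner_of L' L"
    using syzygy_corner[OF L rM corner_of_corner] by blast
  have "iso_direct_summand A K' (rmod_sum (corner P) L')"
    by (rule iso_direct_summand_corner[OF rK K'(2) right_module_sum[OF rP rL]
          corner_of_sum[OF corner_of_corner L'(2)] summand])
  moreover have "fg_right_module A (corner P)" "fg_right_module A (corner M)"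
    using P M P.fin_gen_corner M.fin_gen_corner P.right_module_corner M.right_module_corner
    by (auto simp: fg_right_module_def)
  moreover have "projective_rmod A (corner P)"
    by (rule projective_corner[OF P(2) corner_of_corner])
  ultimately show ?thesis
    unfolding deloops_at_def using K'(1) L'(1) by blast
qed

theorem del_corner_le: "del A \<le> del C"
  unfolding del_def
proof (rule Sup_least, clarify)
  fix S :: "'a rmod" assume S: "simple_right_module A S"
  then have rS: "right_module A S" by (simp add: simple_right_module_def)
  have "del_module A S \<le> del_module C (inflation S)"
    \<comment> \<open>Each index that deloops the inflation also deloops \<open>S\<close>, so the
      infimum for \<open>S\<close> is taken over a larger set.\<close>
    unfolding del_module_def
    using deloops_at_corner[OF _ right_module_inflation[OF rS] corner_of_inflation[OF rS]]
    by (intro Inf_superset_mono) auto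
  also have "\<dots> \<le> Sup {del_module C S |S :: 'a rmod. simple_right_module C S}"
    using simple_inflation[OF S] by (intro Sup_upper) auto
  finally show "del_module A S \<le> \<dots>" .
qed

end


section \<open>Chain conditions\<close>

text \<open>The recursion contributes one coefficient per generator, which lets the chain condition
  be proved by removing one generator at a time.\<close>

fun gen_span :: "('r, 'c) ring_scheme \<Rightarrow> ('r, 'm, 'd) module_scheme \<Rightarrow> 'm list \<Rightarrow> 'm set" where
  "gen_span R M [] = {\<zero>\<^bsub>M\<^esub>}"
| "gen_span R M (g # gs) =
    {r \<odot>\<^bsub>M\<^esub> g \<oplus>\<^bsub>M\<^esub> y | r y. r \<in> carrier R \<and> y \<in> gen_span R M gs}"

context right_module
begin

lemma gen_span_submodule:
  "set gs \<subseteq> carrier M \<Longrightarrow> submodule (gen_span A M gs) A M"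
proof (induction gs)
  case Nil
  then show ?case by (auto simp: submodule_iff ract_zero_right)
next
  case (Cons g gs)
  let ?S = "gen_span A M gs" and ?T = "gen_span A M (g # gs)"
  have g: "g \<in> carrier M" using Cons.prems by simp
  have S: "?S \<subseteq> carrier M" "\<zero>\<^bsub>M\<^esub> \<in> ?S"
    "\<And>x y. x \<in> ?S \<Longrightarrow> y \<in> ?S \<Longrightarrow> x \<oplus>\<^bsub>M\<^esub> y \<in> ?S"
    "\<And>a x. a \<in> carrier A \<Longrightarrow> x \<in> ?S \<Longrightarrow> a \<odot>\<^bsub>M\<^esub> x \<in> ?S"
    using Cons by (auto simp: submodule_iff)
  have memI: "r \<odot>\<^bsub>M\<^esub> g \<oplus>\<^bsub>M\<^esub> y \<in> ?T" if "r \<in> carrier A" "y \<in> ?S" for r y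
    using that by auto
  have "x \<oplus>\<^bsub>M\<^esub> x' \<in> ?T" if x: "x \<in> ?T" "x' \<in> ?T" for x x'
  proof -
    obtain r y r' y' where *: "x = r \<odot>\<^bsub>M\<^esub> g \<oplus>\<^bsub>M\<^esub> y" "r \<in> carrier A" "y \<in> ?S"
      "x' = r' \<odot>\<^bsub>M\<^esub> g \<oplus>\<^bsub>M\<^esub> y'" "r' \<in> carrier A" "y' \<in> ?S"
      using x by auto
    have "x \<oplus>\<^bsub>M\<^esub> x' = (r \<oplus>\<^bsub>A\<^esub> r') \<odot>\<^bsub>M\<^esub> g \<oplus>\<^bsub>M\<^esub> (y \<oplus>\<^bsub>M\<^esub> y')"
      using * g S(1) by (simp add: ract_add_ring ract_closed subset_iff M.a_ac)
    then show ?thesis using * S(3) memI by simp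
  qed
  moreover have "a \<odot>\<^bsub>M\<^esub> x \<in> ?T" if a: "a \<in> carrier A" and x: "x \<in> ?T" for a x
  proof -
    obtain r y where *: "x = r \<odot>\<^bsub>M\<^esub> g \<oplus>\<^bsub>M\<^esub> y" "r \<in> carrier A" "y \<in> ?S"
      using x by auto
    have "a \<odot>\<^bsub>M\<^esub> x = (r \<otimes>\<^bsub>A\<^esub> a) \<odot>\<^bsub>M\<^esub> g \<oplus>\<^bsub>M\<^esub> a \<odot>\<^bsub>M\<^esub> y"
      using * a g S(1) by (simp add: ract_add_module ract_assoc ract_closed subset_iff)
    then show ?thesis using * a S(4) memI by simp
  qed
  moreover have "\<zero>\<^bsub>M\<^esub> \<in> ?T"
    using memI[OF R.zero_closed S(2)] g by (simp add: ract_zero_left)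
  moreover have "?T \<subseteq> carrier M"
    using g S(1) by (auto simp: ract_closed)
  ultimately show ?case unfolding submodule_iff by blast
qed

lemma gen_span_contains: "set gs \<subseteq> carrier M \<Longrightarrow> set gs \<subseteq> gen_span A M gs"
proof (induction gs)
  case (Cons g gs)
  then have g: "g \<in> carrier M" and S: "submodule (gen_span A M gs) A M"
    using gen_span_submodule by auto
  have "g \<in> gen_span A M (g # gs)"
    using S g by (auto simp: submodule_iff ract_one intro!: exI[of _ "\<one>\<^bsub>A\<^esub>"] exI[of _ "\<zero>\<^bsub>M\<^esub>"])
  moreover have "h \<in> gen_span A M (g # gs)" if "h \<in> set gs" for h
    using Cons that g
    by (auto simp: ract_zero_left intro!: exI[of _ "\<zero>\<^bsub>A\<^esub>"] exI[of _ h])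
  ultimately show ?case by auto
qed simp

end

text \<open>Finitely generated modules over an Artinian commutative ring are Artinian. Intersecting
  with a partial span makes induction on the generators possible: a chain is controlled by its part
  inside the smaller span and by a descending chain of ideals of leading coefficients.\<close>

lemma descending_chain_stable:
  assumes "artinian_cring R" "right_module R M"
    and "set gs \<subseteq> carrier M" "\<And>i. submodule (N i) R M" "\<And>i. N (Suc i) \<subseteq> N i"
  shows "\<exists>j. \<forall>i\<ge>j. N j \<inter> gen_span R M gs \<subseteq> N i"
  using assms(3)
proof (induction gs)
  case Nil
  interpret right_module R M by fact
  show ?case using assms(4) by (auto simp: submodule_iff)
next
  case (Cons g gs)
  interpret right_module R M by fact
  interpret cring R using assms(1) by (simp add: artinian_cring_def)
  let ?S = "gen_span R M gs"
  have anti: "N i \<subseteq> N j" if "j \<le> i" for i j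
    using that lift_Suc_antimono_le[of N] assms(5) by blast
  have N: "N i \<subseteq> carrier M" "\<zero>\<^bsub>M\<^esub> \<in> N i" "x \<in> N i \<Longrightarrow> y \<in> N i \<Longrightarrow> x \<oplus>\<^bsub>M\<^esub> y \<in> N i"
    "a \<in> carrier R \<Longrightarrow> x \<in> N i \<Longrightarrow> a \<odot>\<^bsub>M\<^esub> x \<in> N i" for i x y a
    using assms(4)[of i] by (auto simp: submodule_iff)
  have g: "g \<in> carrier M" and subS: "submodule ?S R M"
    using Cons.prems gen_span_submodule by auto
  have S: "?S \<subseteq> carrier M" "\<zero>\<^bsub>M\<^esub> \<in> ?S"
    "\<And>x y. x \<in> ?S \<Longrightarrow> y \<in> ?S \<Longrightarrow> x \<oplus>\<^bsub>M\<^esub> y \<in> ?S"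
    "\<And>a x. a \<in> carrier R \<Longrightarrow> x \<in> ?S \<Longrightarrow> a \<odot>\<^bsub>M\<^esub> x \<in> ?S"
    using subS by (auto simp: submodule_iff)
  \<comment> \<open>the ideal of leading coefficients of \<open>N i\<close> with respect to the generator \<open>g\<close>\<close>
  define I where "I i = {r \<in> carrier R. \<exists>y\<in>?S. r \<odot>\<^bsub>M\<^esub> g \<oplus>\<^bsub>M\<^esub> y \<in> N i}" for i
  have memI: "r \<in> I i" if "r \<in> carrier R" "y \<in> ?S" "r \<odot>\<^bsub>M\<^esub> g \<oplus>\<^bsub>M\<^esub> y \<in> N i" for r y i
    using that by (auto simp: I_def)
  have mult: "r \<otimes>\<^bsub>R\<^esub> a \<in> I i" if rI: "r \<in> I i" and a: "a \<in> carrier R" for r a i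
  proof -
    obtain y where y: "r \<in> carrier R" "y \<in> ?S" "r \<odot>\<^bsub>M\<^esub> g \<oplus>\<^bsub>M\<^esub> y \<in> N i"
      using rI unfolding I_def by blast
    have "a \<odot>\<^bsub>M\<^esub> (r \<odot>\<^bsub>M\<^esub> g \<oplus>\<^bsub>M\<^esub> y) = (r \<otimes>\<^bsub>R\<^esub> a) \<odot>\<^bsub>M\<^esub> g \<oplus>\<^bsub>M\<^esub> a \<odot>\<^bsub>M\<^esub> y"
      using y a g S(1) by (simp add: ract_add_module ract_assoc ract_closed subset_iff)
    then show ?thesis
      using y a N(4)[OF a y(3)] S(4) by (intro memI[of _ "a \<odot>\<^bsub>M\<^esub> y"]) auto
  qed
  have add: "r \<oplus>\<^bsub>R\<^esub> r' \<in> I i" if rI: "r \<in> I i" "r' \<in> I i" for r r' i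
  proof -
    obtain y y' where y: "r \<in> carrier R" "y \<in> ?S" "r \<odot>\<^bsub>M\<^esub> g \<oplus>\<^bsub>M\<^esub> y \<in> N i"
      "r' \<in> carrier R" "y' \<in> ?S" "r' \<odot>\<^bsub>M\<^esub> g \<oplus>\<^bsub>M\<^esub> y' \<in> N i"
      using rI unfolding I_def by blast
    have "(r \<odot>\<^bsub>M\<^esub> g \<oplus>\<^bsub>M\<^esub> y) \<oplus>\<^bsub>M\<^esub> (r' \<odot>\<^bsub>M\<^esub> g \<oplus>\<^bsub>M\<^esub> y')
        = (r \<oplus>\<^bsub>R\<^esub> r') \<odot>\<^bsub>M\<^esub> g \<oplus>\<^bsub>M\<^esub> (y \<oplus>\<^bsub>M\<^esub> y')"
      using y g S(1) by (simp add: ract_add_ring ract_closed subset_iff M.a_ac)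
    then show ?thesis
      using y S(3) N(3)[OF y(3,6)] by (intro memI[of _ "y \<oplus>\<^bsub>M\<^esub> y'"]) auto
  qed
  have "ideal (I i) R" for i
  proof (rule idealI)
    have "\<zero>\<^bsub>R\<^esub> \<in> I i"
      using S(2) N(2) g by (intro memI[of _ "\<zero>\<^bsub>M\<^esub>"]) (auto simp: ract_zero_left)
    moreover have "\<ominus>\<^bsub>R\<^esub> r \<in> I i" if "r \<in> I i" for r
      using mult[OF that, of "\<ominus>\<^bsub>R\<^esub> \<one>\<^bsub>R\<^esub>"] that by (simp add: I_def R.r_minus)
    ultimately show "subgroup (I i) (add_monoid R)"
      using add by (intro subgroup.intro) (auto simp: I_def simp flip: a_inv_def)
  qed (use mult R.ring_axioms in \<open>auto simp: I_def m_comm\<close>)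
  moreover have "I (Suc i) \<subseteq> I i" for i
    using assms(5)[of i] by (auto simp: I_def)
  ultimately obtain j2 where j2: "\<And>i. i \<ge> j2 \<Longrightarrow> I i = I j2"
    using assms(1) unfolding artinian_cring_def by blast
  obtain j1 where j1: "\<And>i. i \<ge> j1 \<Longrightarrow> N j1 \<inter> ?S \<subseteq> N i"
    using Cons by auto
  show ?case
  proof (intro exI[of _ "max j1 j2"] allI impI subsetI)
    fix i x
    assume i: "max j1 j2 \<le> i" and x: "x \<in> N (max j1 j2) \<inter> gen_span R M (g # gs)"
    then obtain r y where ry: "x = r \<odot>\<^bsub>M\<^esub> g \<oplus>\<^bsub>M\<^esub> y" "r \<in> carrier R" "y \<in> ?S"
      by auto
    then have "r \<in> I (max j1 j2)" using x by (intro memI[of _ y]) auto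
    \<comment> \<open>The ideals are stable from \<open>j2\<close> on, so \<open>N i\<close> has an
      element with the same leading coefficient \<open>r\<close> as \<open>x\<close>. Its difference
      from \<open>x\<close> loses the generator \<open>g\<close> and falls under the induction
      hypothesis.\<close>
    then have "r \<in> I i" using j2[of i] j2[of "max j1 j2"] i by auto
    then obtain y' where y': "y' \<in> ?S" "r \<odot>\<^bsub>M\<^esub> g \<oplus>\<^bsub>M\<^esub> y' \<in> N i"
      unfolding I_def by blast
    let ?x' = "r \<odot>\<^bsub>M\<^esub> g \<oplus>\<^bsub>M\<^esub> y'"
    have c: "y \<in> carrier M" "y' \<in> carrier M" "r \<odot>\<^bsub>M\<^esub> g \<in> carrier M"
      using ry y' S(1) g by (auto simp: ract_closed)
    have "\<ominus>\<^bsub>M\<^esub> ?x' = \<ominus>\<^bsub>M\<^esub> (r \<odot>\<^bsub>M\<^esub> g) \<ominus>\<^bsub>M\<^esub> y'"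
      using c by (simp add: M.minus_add M.minus_eq)
    then have diff: "x \<ominus>\<^bsub>M\<^esub> ?x' = y \<ominus>\<^bsub>M\<^esub> y'"
      using c ry(1) by (simp add: M.minus_eq M.a_ac M.r_neg M.r_neg1 M.r_neg2)
    have "x \<in> N j1" "?x' \<in> N j1"
      using x y'(2) anti[of j1 "max j1 j2"] anti[of j1 i] i by auto
    then have "y \<ominus>\<^bsub>M\<^esub> y' \<in> N j1"
      unfolding diff[symmetric] by (rule submodule_diff[OF assms(4)])
    then have d: "y \<ominus>\<^bsub>M\<^esub> y' \<in> N i"
      using j1[of i] i submodule_diff[OF subS ry(3) y'(1)] by auto
    have "x = ?x' \<oplus>\<^bsub>M\<^esub> (x \<ominus>\<^bsub>M\<^esub> ?x')"
      using c ry(1) by (intro M.add_diff_cancel[symmetric]) auto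
    then show "x \<in> N i"
      using N(3)[OF y'(2) d] diff by simp
  qed
qed

text \<open>Without a minimal element, dependent choice builds a strictly descending chain; it would
  have to become stable on the span of the generators, which is the whole module.\<close>

lemma submodule_minimal:
  assumes R: "artinian_cring R" and M: "right_module R M" and fg: "fin_gen R M"
    and sub: "\<And>N. N \<in> S \<Longrightarrow> submodule N R M" and ne: "S \<noteq> {}"
  obtains N where "N \<in> S" "\<And>N'. N' \<in> S \<Longrightarrow> N' \<subseteq> N \<Longrightarrow> N' = N"
proof -
  interpret right_module R M by fact
  obtain gs where gs: "set gs \<subseteq> carrier M"
    "\<And>N. submodule N R M \<Longrightarrow> set gs \<subseteq> N \<Longrightarrow> N = carrier M"
    using fg unfolding fin_gen_def by (metis finite_list)
  have span: "gen_span R M gs = carrier M"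
    using gs gen_span_submodule gen_span_contains by blast
  have "\<exists>N\<in>S. \<forall>N'\<in>S. N' \<subseteq> N \<longrightarrow> N' = N"
  proof (rule ccontr)
    assume "\<not> ?thesis"
    then have step: "\<exists>N'. N' \<in> S \<and> N' \<subset> N" if "N \<in> S" for N
      using that by blast
    have "\<exists>N. \<forall>i. N i \<in> S \<and> N (Suc i) \<subset> N i"
      by (rule dependent_nat_choice) (use ne step in blast)+
    then obtain N where N: "\<And>i. N i \<in> S" "\<And>i. N (Suc i) \<subset> N i"
      by blast
    then have "\<exists>j. \<forall>i\<ge>j. N j \<inter> gen_span R M gs \<subseteq> N i"
      by (intro descending_chain_stable[OF R M gs(1)] sub) auto
    then obtain j where "N j \<inter> gen_span R M gs \<subseteq> N (Suc j)"
      by (meson le_SucI le_refl)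
    moreover have "N j \<subseteq> carrier M"
      using sub[OF N(1)[of j]] by (simp add: submodule_iff)
    ultimately have "N j \<subseteq> N (Suc j)"
      unfolding span by blast
    then show False using N(2)[of j] by blast
  qed
  then show thesis using that by blast
qed


section \<open>Right ideals\<close>

text \<open>The factors in \<open>smult\<close> are swapped because this field denotes a right
  action. Its submodules are then the right ideals.\<close>

definition regular_module :: "('a, 'c) ring_scheme \<Rightarrow> ('a, 'a) module" where
  "regular_module A = \<lparr>carrier = carrier A, mult = mult A, one = \<one>\<^bsub>A\<^esub>, zero = \<zero>\<^bsub>A\<^esub>,
    add = add A, smult = (\<lambda>a x. x \<otimes>\<^bsub>A\<^esub> a)\<rparr>"

lemma regular_module_simps [simp]:
  "carrier (regular_module A) = carrier A" "\<zero>\<^bsub>regular_module A\<^esub> = \<zero>\<^bsub>A\<^esub>"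
  "x \<oplus>\<^bsub>regular_module A\<^esub> y = x \<oplus>\<^bsub>A\<^esub> y" "a \<odot>\<^bsub>regular_module A\<^esub> x = x \<otimes>\<^bsub>A\<^esub> a"
  by (simp_all add: regular_module_def)

lemma (in ring) regular_right_module: "right_module R (regular_module R)"
proof -
  have "abelian_group (regular_module R)"
    by (rule abelian_group_image[of R "\<lambda>x. x"]) (auto intro: abelian_group_axioms)
  then show ?thesis
    by (intro right_module.intro right_module_axioms.intro ring_axioms)
      (simp_all add: l_distr r_distr m_assoc)
qed

abbreviation right_ideal :: "'a set \<Rightarrow> ('a, 'c) ring_scheme \<Rightarrow> bool" where
  "right_ideal I A \<equiv> submodule I A (regular_module A)"

lemma (in ring) right_ideal_iff:
  "right_ideal I R \<longleftrightarrow> I \<subseteq> carrier R \<and> \<zero> \<in> I \<and>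
    (\<forall>x\<in>I. \<forall>y\<in>I. x \<oplus> y \<in> I) \<and> (\<forall>a\<in>carrier R. \<forall>x\<in>I. x \<otimes> a \<in> I)"
  by (simp add: right_module.submodule_iff[OF regular_right_module])

text \<open>
  Maximality of \<open>m\<close> in elementwise form: \<open>1 \<in> xA + m\<close> for all \<open>x \<notin> m\<close>.
\<close>

definition maximal_right_ideal :: "'a set \<Rightarrow> ('a, 'c) ring_scheme \<Rightarrow> bool" where
  "maximal_right_ideal m A \<longleftrightarrow> right_ideal m A \<and> \<one>\<^bsub>A\<^esub> \<notin> m \<and>
    (\<forall>x\<in>carrier A - m. \<exists>c\<in>carrier A. \<one>\<^bsub>A\<^esub> \<ominus>\<^bsub>A\<^esub> x \<otimes>\<^bsub>A\<^esub> c \<in> m)"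

definition jacobson_radical :: "('a, 'c) ring_scheme \<Rightarrow> 'a set" where
  "jacobson_radical A = {x \<in> carrier A. \<forall>m. maximal_right_ideal m A \<longrightarrow> x \<in> m}"

context ring
begin

lemma right_idealD:
  assumes "right_ideal I R"
  shows "\<And>x. x \<in> I \<Longrightarrow> x \<in> carrier R" "\<zero> \<in> I"
    "\<And>x y. x \<in> I \<Longrightarrow> y \<in> I \<Longrightarrow> x \<oplus> y \<in> I"
    "\<And>x y. x \<in> I \<Longrightarrow> y \<in> I \<Longrightarrow> x \<ominus> y \<in> I"
    "\<And>x a. x \<in> I \<Longrightarrow> a \<in> carrier R \<Longrightarrow> x \<otimes> a \<in> I"
proof -
  show *: "\<And>x. x \<in> I \<Longrightarrow> x \<in> carrier R" "\<zero> \<in> I"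
    "\<And>x y. x \<in> I \<Longrightarrow> y \<in> I \<Longrightarrow> x \<oplus> y \<in> I"
    "\<And>x a. x \<in> I \<Longrightarrow> a \<in> carrier R \<Longrightarrow> x \<otimes> a \<in> I"
    using assms by (auto simp: right_ideal_iff)
  show "x \<ominus> y \<in> I" if "x \<in> I" "y \<in> I" for x y
  proof -
    have "y \<otimes> (\<ominus> \<one>) = \<ominus> y" using *(1)[OF that(2)] by (simp add: r_minus)
    then have "\<ominus> y \<in> I" using *(4)[OF that(2), of "\<ominus> \<one>"] by simp
    then show ?thesis using *(3)[OF that(1)] by (simp add: minus_eq)
  qed
qed

lemma maximal_right_idealD:
  assumes "maximal_right_ideal m R"
  shows "right_ideal m R" "\<one> \<notin> m"
    "\<And>x. x \<in> carrier R \<Longrightarrow> x \<notin> m \<Longrightarrow> \<exists>c\<in>carrier R. \<one> \<ominus> x \<otimes> c \<in> m"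
  using assms by (auto simp: maximal_right_ideal_def)

text \<open>This right ideal is the annihilator of the class of \<open>a\<close>, a nonzero element
  of the simple module \<open>R/m\<close>.\<close>

lemma maximal_right_ideal_quotient:
  assumes m: "maximal_right_ideal m R" and a: "a \<in> carrier R" "a \<notin> m"
  shows "maximal_right_ideal {b \<in> carrier R. a \<otimes> b \<in> m} R"
proof -
  note I = right_idealD[OF maximal_right_idealD(1)[OF m]]
  have "right_ideal {b \<in> carrier R. a \<otimes> b \<in> m} R"
    using I a by (auto simp: right_ideal_iff r_distr simp flip: m_assoc)
  moreover have "\<exists>c\<in>carrier R. \<one> \<ominus> x \<otimes> c \<in> {b \<in> carrier R. a \<otimes> b \<in> m}"
    if x: "x \<in> carrier R" "a \<otimes> x \<notin> m" for x
  proof -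
    obtain c where c: "c \<in> carrier R" "\<one> \<ominus> a \<otimes> x \<otimes> c \<in> m"
      using maximal_right_idealD(3)[OF m, of "a \<otimes> x"] x a by auto
    \<comment> \<open>The identity \<open>a (1 - x c a) = (1 - a x c) a\<close> explains the witness
      \<open>c a\<close>: the right side lies in \<open>m\<close> because \<open>1 - a x c\<close>
      does.\<close>
    have "a \<otimes> (\<one> \<ominus> x \<otimes> (c \<otimes> a)) = (\<one> \<ominus> a \<otimes> x \<otimes> c) \<otimes> a"
      using a x c by (simp add: minus_eq r_distr l_distr r_minus l_minus m_assoc)
    then show ?thesis
      using a x c I(5)[OF c(2) a(1)] by (intro bexI[of _ "c \<otimes> a"]) auto
  qed
  ultimately show ?thesis
    using a by (auto simp: maximal_right_ideal_def)
qed

lemma jacobson_radical_right_ideal: "right_ideal (jacobson_radical R) R"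
  using right_idealD[OF maximal_right_idealD(1)]
  by (simp add: right_ideal_iff jacobson_radical_def subset_iff)

text \<open>For \<open>a\<close> outside \<open>m\<close>, the element \<open>x\<close> also lies in
  the maximal right ideal of all \<open>b\<close> with \<open>a b\<close> in \<open>m\<close>. Being
  two-sided is what lets \<open>A/J\<close> serve as a bimodule.\<close>

lemma jacobson_radical_left_mult:
  assumes "a \<in> carrier R" "x \<in> jacobson_radical R"
  shows "a \<otimes> x \<in> jacobson_radical R"
proof -
  have x: "x \<in> carrier R" using assms by (simp add: jacobson_radical_def)
  have "a \<otimes> x \<in> m" if m: "maximal_right_ideal m R" for m
  proof (cases "a \<in> m")
    case True
    then show ?thesis using right_idealD(5)[OF maximal_right_idealD(1)[OF m]] x by simp
  next
    case False
    then show ?thesis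
      using maximal_right_ideal_quotient[OF m assms(1)] assms(2) by (auto simp: jacobson_radical_def)
  qed
  then show ?thesis using assms(1) x by (simp add: jacobson_radical_def)
qed

text \<open>
  The simple module \<open>A/m\<close> embeds in \<open>A/J\<close>: take \<open>I\<close> minimal among the right ideals not
  contained in \<open>m\<close>. Then \<open>I \<inter> m\<close> lies in every maximal right ideal \<open>n\<close>, since \<open>w \<in> I \<inter> m\<close>
  with \<open>w \<notin> n\<close> would give \<open>I \<inter> n \<not>\<subseteq> m\<close>, hence \<open>I \<subseteq> n\<close> by minimality.
\<close>

lemma maximal_right_ideal_socle:
  assumes min: "\<And>S. S \<noteq> {} \<Longrightarrow> (\<And>I. I \<in> S \<Longrightarrow> right_ideal I R) \<Longrightarrow>
      \<exists>I\<in>S. \<forall>I'\<in>S. I' \<subseteq> I \<longrightarrow> I' = I"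
    and m: "maximal_right_ideal m R"
  obtains x where "x \<in> carrier R" "x \<notin> jacobson_radical R"
    "\<And>z. z \<in> m \<Longrightarrow> x \<otimes> z \<in> jacobson_radical R"
proof -
  note mI = right_idealD[OF maximal_right_idealD(1)[OF m]]
  let ?S = "{I. right_ideal I R \<and> \<not> I \<subseteq> m}"
  have "right_ideal (carrier R) R" by (auto simp: right_ideal_iff)
  then have "carrier R \<in> ?S" using maximal_right_idealD(2)[OF m] by auto
  then have "\<exists>I\<in>?S. \<forall>I'\<in>?S. I' \<subseteq> I \<longrightarrow> I' = I"
    by (intro min) blast+
  then obtain I where I: "right_ideal I R" "\<not> I \<subseteq> m"
    and Imin: "\<And>I'. right_ideal I' R \<Longrightarrow> \<not> I' \<subseteq> m \<Longrightarrow> I' \<subseteq> I \<Longrightarrow> I' = I"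
    by blast
  note II = right_idealD[OF I(1)]
  obtain x0 where x0: "x0 \<in> I" "x0 \<notin> m" using I(2) by blast
  \<comment> \<open>The element \<open>x0 c\<close> is congruent to 1 modulo \<open>m\<close>. Hence
    left multiplication by it sends \<open>m\<close> into \<open>m\<close>, and into
    \<open>I\<close> because \<open>x0\<close> lies in \<open>I\<close>.\<close>
  obtain c where c: "c \<in> carrier R" "\<one> \<ominus> x0 \<otimes> c \<in> m"
    using maximal_right_idealD(3)[OF m II(1)[OF x0(1)] x0(2)] by blast
  let ?x = "x0 \<otimes> c"
  have xI: "?x \<in> I" and x: "?x \<in> carrier R"
    using II x0(1) c(1) by auto
  have xm: "?x \<notin> m"
  proof
    assume "?x \<in> m"
    then have "(\<one> \<ominus> ?x) \<oplus> ?x \<in> m" using mI(3) c(2) by blast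
    then show False using x maximal_right_idealD(2)[OF m] by (simp add: minus_eq a_assoc l_neg)
  qed
  have xz: "?x \<otimes> z \<in> I \<inter> m" if z: "z \<in> m" for z
  proof -
    have zc: "z \<in> carrier R" using mI z by blast
    have "z \<ominus> (\<one> \<ominus> ?x) \<otimes> z \<in> m" using z zc mI(4) mI(5)[OF c(2)] by blast
    moreover have "z \<ominus> (\<one> \<ominus> ?x) \<otimes> z = ?x \<otimes> z"
      using zc x by (simp add: minus_eq l_distr l_minus minus_add r_neg1 r_neg2)
    ultimately show ?thesis using II(5)[OF xI zc] by simp
  qed
  have "w \<in> n" if w: "w \<in> I \<inter> m" and n: "maximal_right_ideal n R" for w n
  proof (rule ccontr)
    assume wn: "w \<notin> n"
    note nI = right_idealD[OF maximal_right_idealD(1)[OF n]]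
    have wc: "w \<in> carrier R" using w II by blast
    obtain d where d: "d \<in> carrier R" "\<one> \<ominus> w \<otimes> d \<in> n"
      using maximal_right_idealD(3)[OF n wc wn] by blast
    \<comment> \<open>A witness in \<open>I\<close> and \<open>n\<close> but outside
      \<open>m\<close>: it lies in \<open>n\<close> through its first factor, and it differs from
      \<open>?x\<close> by an element of \<open>I\<close> and \<open>m\<close>, with
      \<open>?x\<close> in \<open>I\<close> and not in \<open>m\<close>.\<close>
    let ?y = "(\<one> \<ominus> w \<otimes> d) \<otimes> ?x"
    have y: "?y = ?x \<ominus> w \<otimes> (d \<otimes> ?x)"
      using x wc d by (simp add: minus_eq l_distr l_minus m_assoc)
    have wdx: "w \<otimes> (d \<otimes> ?x) \<in> I" "w \<otimes> (d \<otimes> ?x) \<in> m"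
      using w d(1) x II(5) mI(5) by auto
    have "?y \<in> n" using nI(5)[OF d(2) x] .
    moreover have "?y \<in> I" unfolding y by (rule II(4)[OF xI wdx(1)])
    moreover have "?y \<notin> m"
    proof
      assume "?y \<in> m"
      then have "?y \<oplus> w \<otimes> (d \<otimes> ?x) \<in> m" using mI(3) wdx(2) by blast
      moreover have "?y \<oplus> w \<otimes> (d \<otimes> ?x) = ?x"
        unfolding y using x wc d(1) by (simp add: minus_eq a_assoc l_neg)
      ultimately show False using xm by argo
    qed
    ultimately have "\<not> I \<inter> n \<subseteq> m" by blast
    moreover have "right_ideal (I \<inter> n) R"
      using II nI by (auto simp: right_ideal_iff)
    ultimately have "I \<inter> n = I" using Imin by blast
    then show False using w wn by blast
  qed
  then have "?x \<otimes> z \<in> jacobson_radical R" if "z \<in> m" for z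
    using xz[OF that] x mI(1)[OF that] unfolding jacobson_radical_def by blast
  moreover have "?x \<notin> jacobson_radical R"
    using xm m unfolding jacobson_radical_def by blast
  ultimately show thesis using that x by blast
qed

end


section \<open>Algebras of delooping level zero\<close>

lemma iso_direct_summand_sum:
  assumes "right_module A P" "right_module A L" "rmod_isomorphic A X L"
  shows "iso_direct_summand A X (rmod_sum P L)"
proof -
  interpret P: right_module A P by fact
  interpret L: right_module A L by fact
  interpret Y: right_module A "rmod_sum P L" using assms by (intro right_module_sum)
  let ?Y = "rmod_sum P L"
  let ?U = "{\<zero>\<^bsub>P\<^esub>} \<times> carrier L" and ?V = "carrier P \<times> {\<zero>\<^bsub>L\<^esub>}"
  obtain f where f: "f \<in> rmod_hom A X L" "bij_betw f (carrier X) (carrier L)"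
    using assms(3) unfolding rmod_isomorphic_def by blast
  have "submodule ?U A ?Y" "submodule ?V A ?Y"
    unfolding Y.submodule_iff
    by (auto simp: rmod_sum_def P.ract_closed L.ract_closed P.ract_zero_right L.ract_zero_right)
  moreover have "?U <+>\<^bsub>?Y\<^esub> ?V = carrier ?Y"
  proof -
    have "(x, y) \<in> ?U <+>\<^bsub>?Y\<^esub> ?V" if "x \<in> carrier P" "y \<in> carrier L" for x y
      unfolding set_add_def' using that
      by (intro UN_I[of "(\<zero>\<^bsub>P\<^esub>, y)"] UN_I[of "(x, \<zero>\<^bsub>L\<^esub>)"]) (auto simp: rmod_sum_def)
    then show ?thesis
      by (auto simp: set_add_def') (auto simp: rmod_sum_def)
  qed
  moreover have "?U \<inter> ?V = {\<zero>\<^bsub>?Y\<^esub>}"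
    by (auto simp: rmod_sum_def)
  moreover have "rmod_isomorphic A X (restr_module ?Y ?U)"
    unfolding rmod_isomorphic_def
  proof (intro bexI)
    show "(\<lambda>x. (\<zero>\<^bsub>P\<^esub>, f x)) \<in> rmod_hom A X (restr_module ?Y ?U)"
      using rmod_homD[OF f(1)]
      by (auto simp: rmod_hom_def restr_module_def rmod_sum_def P.ract_zero_right)
    show "bij_betw (\<lambda>x. (\<zero>\<^bsub>P\<^esub>, f x)) (carrier X) (carrier (restr_module ?Y ?U))"
      using f(2) by (auto simp: bij_betw_def inj_on_def restr_module_def)
  qed
  ultimately show ?thesis
    unfolding iso_direct_summand_def by blast
qed

text \<open>Modules of type \<open>rmod\<close> have sets of functions as elements; singletons of
  constant functions provide a copy of the ring among them.\<close>

definition singleton_embedding :: "'a \<Rightarrow> (nat \<Rightarrow> 'a) set" where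
  "singleton_embedding c = {\<lambda>_. c}"

lemma inj_singleton_embedding: "inj singleton_embedding"
  by (rule injI) (simp add: singleton_embedding_def fun_eq_iff)

definition regular_rmod :: "('a, 'c) ring_scheme \<Rightarrow> 'a rmod" where
  "regular_rmod A = image_module singleton_embedding (regular_module A)"

text \<open>The chosen element depends only on the coset of \<open>x\<close>, so it serves as a name
  for the coset. Quotients thereby keep elements of type \<open>'a\<close> instead of sets.\<close>

definition coset_rep :: "('a, 'c) ring_scheme \<Rightarrow> 'a set \<Rightarrow> 'a \<Rightarrow> 'a" where
  "coset_rep A I x = (SOME y. y \<in> carrier A \<and> y \<ominus>\<^bsub>A\<^esub> x \<in> I)"

definition quotient_rmod :: "('a, 'c) ring_scheme \<Rightarrow> 'a set \<Rightarrow> 'a rmod" where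
  "quotient_rmod A I = image_module (\<lambda>c. singleton_embedding (coset_rep A I c)) (regular_module A)"

section \<open>The regular module, its quotients, and simple modules as first syzygies\<close>

context ring
begin

abbreviation e :: "'a \<Rightarrow> (nat \<Rightarrow> 'a) set" where "e \<equiv> singleton_embedding"

lemma regular_rmod_hom: "e \<in> rmod_hom R (regular_module R) (regular_rmod R)"
  unfolding regular_rmod_def
  by (intro image_module_hom compat_inj inj_singleton_embedding)

lemma regular_rmod_simps:
  "carrier (regular_rmod R) = e ` carrier R" "\<zero>\<^bsub>regular_rmod R\<^esub> = e \<zero>"
  "x \<in> carrier R \<Longrightarrow> y \<in> carrier R \<Longrightarrow> e x \<oplus>\<^bsub>regular_rmod R\<^esub> e y = e (x \<oplus> y)"
  "x \<in> carrier R \<Longrightarrow> a \<in> carrier R \<Longrightarrow> a \<odot>\<^bsub>regular_rmod R\<^esub> e x = e (x \<otimes> a)"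
  using rmod_homD(2,3)[OF regular_rmod_hom]
  by (simp_all add: regular_rmod_def image_module_simps)

lemma regular_rmod_right_module: "right_module R (regular_rmod R)"
  unfolding regular_rmod_def
  by (intro right_module_image_module compat_inj inj_singleton_embedding regular_right_module)

lemma fin_gen_regular: "fin_gen R (regular_module R)"
  unfolding fin_gen_def
proof (intro exI conjI allI impI)
  fix N assume N: "right_ideal N R" "{\<one>} \<subseteq> N"
  then have "c \<in> N" if "c \<in> carrier R" for c
    using right_idealD(5)[OF N(1), of \<one> c] that by simp
  then show "N = carrier (regular_module R)"
    using right_idealD(1)[OF N(1)] by auto
qed auto

lemma fg_regular_rmod: "fg_right_module R (regular_rmod R)"
  unfolding fg_right_module_def
  by (intro conjI regular_rmod_right_module
      fin_gen_image[OF regular_right_module regular_rmod_right_module regular_rmod_hom _ fin_gen_regular])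
    (simp add: regular_rmod_simps)

lemma projective_regular_rmod: "projective_rmod R (regular_rmod R)"
  unfolding projective_rmod_def
proof (intro conjI allI impI; (elim conjE)?)
  fix N N' :: "'a rmod" and g f
  assume N: "right_module R N" "right_module R N'" and g: "g \<in> rmod_hom R N N'"
    and surj: "g ` carrier N = carrier N'" and f: "f \<in> rmod_hom R (regular_rmod R) N'"
  interpret N: right_module R N by fact
  interpret N': right_module R N' by fact
  have "f (e \<one>) \<in> g ` carrier N"
    unfolding surj by (rule rmod_homD(1)[OF f]) (simp add: regular_rmod_simps)
  then obtain n where n: "n \<in> carrier N" "g n = f (e \<one>)"
    by (metis imageE)
  \<comment> \<open>The regular module is free on \<open>e \<one>\<close>, so a lift is fixed by a
    preimage \<open>n\<close> of the image of this generator.\<close>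
  let ?h = "\<lambda>u. inv_into UNIV e u \<odot>\<^bsub>N\<^esub> n"
  have h: "?h (e c) = c \<odot>\<^bsub>N\<^esub> n" for c
    by (simp add: inv_f_f inj_singleton_embedding)
  have "?h \<in> rmod_hom R (regular_rmod R) N"
    using n(1)
    by (auto simp: rmod_hom_def regular_rmod_simps h N.ract_closed N.ract_add_ring N.ract_assoc)
  moreover have "g (?h u) = f u" if "u \<in> carrier (regular_rmod R)" for u
  proof -
    obtain c where c: "c \<in> carrier R" "u = e c"
      using \<open>u \<in> carrier (regular_rmod R)\<close> by (auto simp: regular_rmod_simps)
    have "g (?h u) = c \<odot>\<^bsub>N'\<^esub> f (e \<one>)"
      using c n rmod_homD(3)[OF g] by (simp add: h)
    also have "\<dots> = f (c \<odot>\<^bsub>regular_rmod R\<^esub> e \<one>)"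
      using c rmod_homD(3)[OF f, of c "e \<one>"] by (simp add: regular_rmod_simps(1))
    finally show ?thesis
      using c by (simp add: regular_rmod_simps)
  qed
  ultimately show "\<exists>h\<in>rmod_hom R (regular_rmod R) N.
      \<forall>x\<in>carrier (regular_rmod R). g (h x) = f x"
    by (intro bexI[of _ ?h] ballI)
qed (rule regular_rmod_right_module)

lemma right_ideal_diff_iff:
  assumes I: "right_ideal I R" and "x \<ominus> y \<in> I" "x \<in> carrier R" "y \<in> carrier R"
  shows "x \<in> I \<longleftrightarrow> y \<in> I"
proof
  assume "y \<in> I"
  then have "y \<oplus> (x \<ominus> y) \<in> I" using right_idealD(3)[OF I] assms(2) by blast
  then show "x \<in> I" using assms by (simp add: add_diff_cancel)
next
  assume "x \<in> I"
  then have "x \<ominus> (x \<ominus> y) \<in> I" using right_idealD(4)[OF I] assms(2) by blast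
  then show "y \<in> I" using assms by (simp add: minus_eq minus_add r_neg2)
qed

text \<open>Congruent elements give the same predicate under \<open>SOME\<close>, hence the same
  choice; conversely, both elements differ from a common representative by elements of
  \<open>I\<close>.\<close>

lemma coset_rep_eq_iff:
  assumes I: "right_ideal I R" and c: "c \<in> carrier R" "c' \<in> carrier R"
  shows "coset_rep R I c = coset_rep R I c' \<longleftrightarrow> c \<ominus> c' \<in> I"
proof
  have diff: "(y \<ominus> c') \<ominus> (y \<ominus> c) = c \<ominus> c'" if y: "y \<in> carrier R" for y
    using y c
    by (simp add: minus_eq minus_add a_comm[of y "\<ominus> c'"] a_comm[of c] a_assoc r_neg2)
  {
    have rep: "coset_rep R I x \<in> carrier R \<and> coset_rep R I x \<ominus> x \<in> I" if x: "x \<in> carrier R" for x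
      unfolding coset_rep_def
      by (rule someI[of _ x]) (use x right_idealD(2)[OF I] in \<open>simp add: minus_eq r_neg\<close>)
    assume "coset_rep R I c = coset_rep R I c'"
    then show "c \<ominus> c' \<in> I"
      using rep[OF c(1)] rep[OF c(2)] diff[of "coset_rep R I c"] right_idealD(4)[OF I] by metis
  next
    assume *: "c \<ominus> c' \<in> I"
    have "y \<ominus> c \<in> I \<longleftrightarrow> y \<ominus> c' \<in> I" if y: "y \<in> carrier R" for y
      using right_ideal_diff_iff[OF I, of "y \<ominus> c'" "y \<ominus> c"] * diff[OF y] y c by simp
    then have "(\<lambda>y. y \<in> carrier R \<and> y \<ominus> c \<in> I) = (\<lambda>y. y \<in> carrier R \<and> y \<ominus> c' \<in> I)"
      by blast
    then show "coset_rep R I c = coset_rep R I c'"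
      unfolding coset_rep_def by (rule arg_cong)
  }
qed

lemma coset_rep_eq_zero_iff:
  assumes "right_ideal I R" "x \<in> carrier R"
  shows "coset_rep R I x = coset_rep R I \<zero> \<longleftrightarrow> x \<in> I"
  using coset_rep_eq_iff[OF assms zero_closed] assms(2) by (simp add: minus_eq)

lemma coset_rep_add:
  assumes I: "right_ideal I R"
    and c: "x \<in> carrier R" "x' \<in> carrier R" "y \<in> carrier R" "y' \<in> carrier R"
    and eq: "coset_rep R I x = coset_rep R I x'" "coset_rep R I y = coset_rep R I y'"
  shows "coset_rep R I (x \<oplus> y) = coset_rep R I (x' \<oplus> y')"
proof -
  have "(x \<ominus> x') \<oplus> (y \<ominus> y') \<in> I"
    using right_idealD(3)[OF I] eq c by (simp add: coset_rep_eq_iff[OF I])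
  moreover have "(x \<ominus> x') \<oplus> (y \<ominus> y') = (x \<oplus> y) \<ominus> (x' \<oplus> y')"
    using c by (simp add: minus_eq minus_add a_ac)
  ultimately show ?thesis
    using c by (simp add: coset_rep_eq_iff[OF I])
qed

lemma coset_rep_right_mult:
  assumes I: "right_ideal I R" and c: "a \<in> carrier R" "x \<in> carrier R" "x' \<in> carrier R"
    and eq: "coset_rep R I x = coset_rep R I x'"
  shows "coset_rep R I (x \<otimes> a) = coset_rep R I (x' \<otimes> a)"
proof -
  have "(x \<ominus> x') \<otimes> a \<in> I"
    using right_idealD(5)[OF I] eq c by (simp add: coset_rep_eq_iff[OF I])
  then show ?thesis
    using c by (simp add: coset_rep_eq_iff[OF I] minus_eq l_distr l_minus)
qed

lemma coset_rep_left_mult: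
  assumes I: "right_ideal I R" and left: "\<And>x. x \<in> I \<Longrightarrow> a \<otimes> x \<in> I"
    and c: "a \<in> carrier R" "x \<in> carrier R" "x' \<in> carrier R"
    and eq: "coset_rep R I x = coset_rep R I x'"
  shows "coset_rep R I (a \<otimes> x) = coset_rep R I (a \<otimes> x')"
proof -
  have "a \<otimes> (x \<ominus> x') \<in> I"
    using left eq c by (simp add: coset_rep_eq_iff[OF I])
  then show ?thesis
    using c by (simp add: coset_rep_eq_iff[OF I] minus_eq r_distr r_minus)
qed

lemma syzygy_quotient:
  assumes I: "right_ideal I R" and sq: "\<And>i. i \<in> I \<Longrightarrow> i \<otimes> i = \<zero>"
  shows "fg_right_module R (quotient_rmod R I)"
    and "syzygy R 1 (quotient_rmod R I) (restr_module (regular_rmod R) (e ` I))"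
proof -
  let ?q = "\<lambda>c. e (coset_rep R I c)" and ?M = "quotient_rmod R I" and ?P = "regular_rmod R"
  note II = right_idealD[OF I]
  have q_eq: "?q x = ?q y \<longleftrightarrow> coset_rep R I x = coset_rep R I y" for x y
    by (rule inj_eq[OF inj_singleton_embedding])
  have compat: "add_compat (regular_module R) ?q" "smult_compat R (regular_module R) ?q"
    unfolding add_compat_def smult_compat_def q_eq regular_module_simps
    by (intro ballI impI coset_rep_add[OF I] coset_rep_right_mult[OF I]; assumption)+
  have q: "?q \<in> rmod_hom R (regular_module R) ?M"
    unfolding quotient_rmod_def by (rule image_module_hom[OF compat])
  have carrM: "carrier ?M = ?q ` carrier R" and zeroM: "\<zero>\<^bsub>?M\<^esub> = ?q \<zero>"
    by (simp_all add: quotient_rmod_def image_module_simps)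
  have rM: "right_module R ?M"
    unfolding quotient_rmod_def by (rule right_module_image_module[OF regular_right_module compat])
  then show fgM: "fg_right_module R ?M"
    unfolding fg_right_module_def
    using fin_gen_image[OF regular_right_module rM q _ fin_gen_regular] by (simp add: carrM)
  interpret P: right_module R ?P by (rule regular_rmod_right_module)
  let ?p = "\<lambda>u. ?q (inv_into UNIV e u)"
  have p: "?p (e c) = ?q c" for c
    by (simp add: inv_f_f inj_singleton_embedding)
  have ker: "a_kernel ?P ?M ?p = e ` I"
  proof -
    have "?q c = \<zero>\<^bsub>?M\<^esub> \<longleftrightarrow> c \<in> I" if "c \<in> carrier R" for c
      using coset_rep_eq_zero_iff[OF I that] by (simp add: zeroM q_eq)
    then have "?p (e c) = \<zero>\<^bsub>?M\<^esub> \<longleftrightarrow> c \<in> I" if "c \<in> carrier R" for c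
      using that by (simp only: p)
    then show ?thesis
      using II(1) unfolding a_kernel_def' regular_rmod_simps(1) by blast
  qed
  have hom: "?p \<in> rmod_hom R ?P ?M"
    using rmod_homD[OF q] by (auto simp: rmod_hom_def regular_rmod_simps p)
  have "superfluous R ?P (e ` I)"
    unfolding superfluous_def
  proof (intro conjI allI impI)
    show "submodule (e ` I) R ?P"
      using submodule_kernel[OF regular_rmod_right_module rM hom] by (simp add: ker)
    fix N assume N: "submodule N R ?P" "e ` I <+>\<^bsub>?P\<^esub> N = carrier ?P"
    have "e \<one> \<in> e ` I <+>\<^bsub>?P\<^esub> N" unfolding N(2) by (simp add: regular_rmod_simps)
    then obtain i n where split: "i \<in> I" "n \<in> N" "e \<one> = e i \<oplus>\<^bsub>?P\<^esub> n"
      by (auto simp: set_add_def')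
    have NP: "N \<subseteq> carrier ?P"
      "\<And>a x. a \<in> carrier R \<Longrightarrow> x \<in> N \<Longrightarrow> a \<odot>\<^bsub>?P\<^esub> x \<in> N"
      using N(1) by (auto simp: P.submodule_iff)
    obtain c where c: "c \<in> carrier R" "n = e c"
      using NP(1) split(2) by (auto simp: regular_rmod_simps)
    have i: "i \<in> carrier R" using split II by blast
    \<comment> \<open>Here \<open>c = 1 - i\<close>, and \<open>c (1 + i) = 1\<close> because
      \<open>i\<close> has square zero. Thus \<open>N\<close> contains an element with a right
      inverse and is everything.\<close>
    have one: "\<one> = i \<oplus> c"
      using split(3) c i by (simp add: regular_rmod_simps inj_eq[OF inj_singleton_embedding])
    have "i = (i \<oplus> c) \<otimes> i" using i by (simp flip: one)
    then have "c \<otimes> i = i"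
      using c i sq[OF split(1)] by (simp add: l_distr)
    then have "c \<otimes> (\<one> \<oplus> i) = i \<oplus> c"
      using c i by (simp add: r_distr a_comm)
    then have "c \<otimes> (\<one> \<oplus> i) = \<one>"
      by (simp only: one)
    have "e x \<in> N" if x: "x \<in> carrier R" for x
    proof -
      have "((\<one> \<oplus> i) \<otimes> x) \<odot>\<^bsub>?P\<^esub> e c = e x"
        using c i x \<open>c \<otimes> (\<one> \<oplus> i) = \<one>\<close> by (simp add: regular_rmod_simps flip: m_assoc)
      then show ?thesis
        using NP(2)[of "(\<one> \<oplus> i) \<otimes> x" "e c"] split(2) c i x by simp
    qed
    then show "N = carrier ?P"
      using NP(1) by (auto simp: regular_rmod_simps)
  qed
  then have "projective_cover R ?P ?p ?M"
    unfolding projective_cover_def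
    using fg_regular_rmod projective_regular_rmod hom
    by (simp add: ker image_image regular_rmod_simps(1) p carrM)
  from syzygy_Suc[OF syzygy_0 this]
  show "syzygy R 1 ?M (restr_module ?P (e ` I))"
    by (simp add: ker)
qed

text \<open>A nonzero element of a simple module generates it. If \<open>x\<close> does not
  annihilate \<open>s\<close>, some \<open>c\<close> carries \<open>s x\<close> back to
  \<open>s\<close>, and then \<open>1 - x c\<close> annihilates \<open>s\<close>.\<close>

lemma maximal_right_ideal_annihilator:
  assumes S: "simple_right_module R S" and s: "s \<in> carrier S" "s \<noteq> \<zero>\<^bsub>S\<^esub>"
  shows "maximal_right_ideal {c \<in> carrier R. c \<odot>\<^bsub>S\<^esub> s = \<zero>\<^bsub>S\<^esub>} R"
    and "(\<lambda>c. c \<odot>\<^bsub>S\<^esub> s) ` carrier R = carrier S"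
proof -
  interpret S: right_module R S using S by (simp add: simple_right_module_def)
  have gen: "(\<lambda>c. c \<odot>\<^bsub>S\<^esub> t) ` carrier R = carrier S"
    if t: "t \<in> carrier S" "t \<noteq> \<zero>\<^bsub>S\<^esub>" for t
  proof -
    have "t \<in> (\<lambda>c. c \<odot>\<^bsub>S\<^esub> t) ` carrier R"
      using t by (intro image_eqI[of _ _ \<one>]) (auto simp: S.ract_one)
    then show ?thesis
      using S t S.submodule_cyclic[OF t(1)] unfolding simple_right_module_def by blast
  qed
  show "(\<lambda>c. c \<odot>\<^bsub>S\<^esub> s) ` carrier R = carrier S"
    by (rule gen[OF s])
  let ?m = "{c \<in> carrier R. c \<odot>\<^bsub>S\<^esub> s = \<zero>\<^bsub>S\<^esub>}"
  have "right_ideal ?m R"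
    using s by (auto simp: right_ideal_iff S.ract_zero_left S.ract_zero_right S.ract_add_ring S.ract_assoc)
  moreover have "\<exists>c\<in>carrier R. \<one> \<ominus> x \<otimes> c \<in> ?m" if x: "x \<in> carrier R - ?m" for x
  proof -
    have "x \<odot>\<^bsub>S\<^esub> s \<in> carrier S" "x \<odot>\<^bsub>S\<^esub> s \<noteq> \<zero>\<^bsub>S\<^esub>"
      using x s by (auto simp: S.ract_closed)
    then obtain c where c: "c \<in> carrier R" "s = c \<odot>\<^bsub>S\<^esub> (x \<odot>\<^bsub>S\<^esub> s)"
      using gen s by blast
    have "(\<one> \<ominus> x \<otimes> c) \<odot>\<^bsub>S\<^esub> s = s \<ominus>\<^bsub>S\<^esub> c \<odot>\<^bsub>S\<^esub> (x \<odot>\<^bsub>S\<^esub> s)"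
      using x s c(1) by (simp add: S.ract_diff_left S.ract_one S.ract_assoc)
    also have "\<dots> = \<zero>\<^bsub>S\<^esub>"
      using s(1) by (simp flip: c(2)) (simp add: S.M.minus_eq S.M.r_neg)
    finally show ?thesis using x c by (intro bexI[of _ c]) auto
  qed
  ultimately show "maximal_right_ideal ?m R"
    using s by (auto simp: maximal_right_ideal_def S.ract_one)
qed

text \<open>
  The hypothesis says that every simple module \<open>A/m\<close> embeds, as \<open>bA\<close>, in the radical of \<open>A\<close>.
  It is then the first syzygy of \<open>A/bA\<close>.
\<close>

lemma del_eq_0:
  assumes emb: "\<And>m. maximal_right_ideal m R \<Longrightarrow> \<exists>b\<in>carrier R. b \<noteq> \<zero> \<and>
      (\<forall>y\<in>m. b \<otimes> y = \<zero>) \<and> (\<forall>c\<in>carrier R. b \<otimes> c \<otimes> b = \<zero>)"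
  shows "del R = 0"
proof -
  have "deloops_at R S 0" if S: "simple_right_module R S" for S :: "'a rmod"
  proof -
    interpret S: right_module R S using S by (simp add: simple_right_module_def)
    obtain s where s: "s \<in> carrier S" "s \<noteq> \<zero>\<^bsub>S\<^esub>"
      using S S.M.zero_closed unfolding simple_right_module_def by blast
    define m where "m = {c \<in> carrier R. c \<odot>\<^bsub>S\<^esub> s = \<zero>\<^bsub>S\<^esub>}"
    have m: "maximal_right_ideal m R" and gen: "(\<lambda>c. c \<odot>\<^bsub>S\<^esub> s) ` carrier R = carrier S"
      unfolding m_def by (rule maximal_right_ideal_annihilator[OF S s])+
    obtain b where b: "b \<in> carrier R" "b \<noteq> \<zero>" "\<And>y. y \<in> m \<Longrightarrow> b \<otimes> y = \<zero>"
      "\<And>c. c \<in> carrier R \<Longrightarrow> b \<otimes> c \<otimes> b = \<zero>"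
      using emb[OF m] by blast
    \<comment> \<open>The annihilators of \<open>b\<close> and \<open>s\<close> coincide. If
      \<open>b c = 0\<close> with \<open>c\<close> outside \<open>m\<close>, choose \<open>d\<close>
      with \<open>1 - c d\<close> in \<open>m\<close>; then \<open>b = b (1 - c d) = 0\<close>, a
      contradiction.\<close>
    have ann: "b \<otimes> c = \<zero> \<longleftrightarrow> c \<odot>\<^bsub>S\<^esub> s = \<zero>\<^bsub>S\<^esub>" if c: "c \<in> carrier R" for c
    proof
      assume bc: "b \<otimes> c = \<zero>"
      show "c \<odot>\<^bsub>S\<^esub> s = \<zero>\<^bsub>S\<^esub>"
      proof (rule ccontr)
        assume "c \<odot>\<^bsub>S\<^esub> s \<noteq> \<zero>\<^bsub>S\<^esub>"
        then obtain d where d: "d \<in> carrier R" "\<one> \<ominus> c \<otimes> d \<in> m"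
          using maximal_right_idealD(3)[OF m c] by (auto simp: m_def)
        have "b \<otimes> (\<one> \<ominus> c \<otimes> d) = b \<ominus> b \<otimes> c \<otimes> d"
          using b(1) c d(1) by (simp add: minus_eq r_distr r_minus m_assoc)
        then show False
          using b(1,2) b(3)[OF d(2)] bc d(1) by (simp add: minus_eq)
      qed
    qed (use b(3) c in \<open>auto simp: m_def\<close>)
    have eq: "b \<otimes> c = b \<otimes> c' \<longleftrightarrow> c \<odot>\<^bsub>S\<^esub> s = c' \<odot>\<^bsub>S\<^esub> s"
      if c: "c \<in> carrier R" "c' \<in> carrier R" for c c'
    proof -
      have "b \<otimes> (c \<ominus> c') = b \<otimes> c \<ominus> b \<otimes> c'"
        using b(1) c by (simp add: minus_eq r_distr r_minus)
      then show ?thesis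
        using ann[of "c \<ominus> c'"] b(1) c s(1) S.ract_closed
        by (simp add: S.ract_diff_left S.M.diff_eq_zero_iff diff_eq_zero_iff)
    qed
    let ?P = "regular_rmod R"
    define I where "I = (\<lambda>c. b \<otimes> c) ` carrier R"
    have I: "right_ideal I R"
      using right_module.submodule_cyclic[OF regular_right_module, of b] b(1) by (simp add: I_def)
    have sq: "i \<otimes> i = \<zero>" if "i \<in> I" for i
    proof -
      obtain c where c: "c \<in> carrier R" "i = b \<otimes> c" using \<open>i \<in> I\<close> by (auto simp: I_def)
      then have "i \<otimes> i = (b \<otimes> c \<otimes> b) \<otimes> c" using b(1) by (simp add: m_assoc)
      then show ?thesis using b(4) c by simp
    qed
    note syz = syzygy_quotient[OF I sq]
    let ?L = "restr_module ?P (e ` I)"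
    have L: "right_module R ?L"
      using right_module_syzygy[OF syz(2)] syz(1) by (simp add: fg_right_module_def)
    \<comment> \<open>The isomorphism from \<open>S\<close> to \<open>b R\<close> sends
      \<open>s c\<close> to \<open>b c\<close>; by \<open>eq\<close> it does not depend on the
      choice of \<open>c\<close> and is injective.\<close>
    define F where "F t = e (b \<otimes> (SOME c. c \<in> carrier R \<and> c \<odot>\<^bsub>S\<^esub> s = t))" for t
    have F: "F (c \<odot>\<^bsub>S\<^esub> s) = e (b \<otimes> c)" if c: "c \<in> carrier R" for c
    proof -
      have "\<exists>c'. c' \<in> carrier R \<and> c' \<odot>\<^bsub>S\<^esub> s = c \<odot>\<^bsub>S\<^esub> s" using c by blast
      from someI_ex[OF this] show ?thesis
        using eq c by (simp add: F_def inj_eq[OF inj_singleton_embedding])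
    qed
    have img: "\<exists>c\<in>carrier R. t = c \<odot>\<^bsub>S\<^esub> s" if "t \<in> carrier S" for t
      using that gen by blast
    have "F \<in> rmod_hom R S ?L"
      unfolding rmod_hom_def
    proof (intro CollectI conjI ballI)
      show "F \<in> carrier S \<rightarrow> carrier ?L"
      proof
        fix t assume "t \<in> carrier S"
        then obtain c where "c \<in> carrier R" "t = c \<odot>\<^bsub>S\<^esub> s" using img by blast
        then show "F t \<in> carrier ?L" by (simp add: F restr_module_def I_def)
      qed
      fix t assume "t \<in> carrier S"
      then obtain c where c: "c \<in> carrier R" "t = c \<odot>\<^bsub>S\<^esub> s" using img by blast
      fix a assume a: "a \<in> carrier R"
      have "a \<odot>\<^bsub>S\<^esub> t = (c \<otimes> a) \<odot>\<^bsub>S\<^esub> s"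
        using a c s by (simp add: S.ract_assoc)
      then show "F (a \<odot>\<^bsub>S\<^esub> t) = a \<odot>\<^bsub>?L\<^esub> F t"
        using a b(1) c by (simp add: F restr_module_def regular_rmod_simps m_assoc)
    next
      fix t u assume "t \<in> carrier S" "u \<in> carrier S"
      then obtain c d where c: "c \<in> carrier R" "t = c \<odot>\<^bsub>S\<^esub> s" "d \<in> carrier R" "u = d \<odot>\<^bsub>S\<^esub> s"
        using img by metis
      have "t \<oplus>\<^bsub>S\<^esub> u = (c \<oplus> d) \<odot>\<^bsub>S\<^esub> s"
        using c s by (simp add: S.ract_add_ring)
      then show "F (t \<oplus>\<^bsub>S\<^esub> u) = F t \<oplus>\<^bsub>?L\<^esub> F u"
        using b(1) c by (simp add: F restr_module_def regular_rmod_simps r_distr)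
    qed
    moreover have "bij_betw F (carrier S) (carrier ?L)"
      unfolding bij_betw_def
    proof
      show "inj_on F (carrier S)"
      proof (rule inj_onI)
        fix t u assume "t \<in> carrier S" "u \<in> carrier S" and Ftu: "F t = F u"
        then obtain c d where c: "c \<in> carrier R" "t = c \<odot>\<^bsub>S\<^esub> s" "d \<in> carrier R" "u = d \<odot>\<^bsub>S\<^esub> s"
          using img by metis
        then show "t = u"
          using Ftu eq by (simp add: F inj_eq[OF inj_singleton_embedding])
      qed
      have "F ` carrier S = (\<lambda>c. F (c \<odot>\<^bsub>S\<^esub> s)) ` carrier R"
        unfolding gen[symmetric] by (rule image_image)
      also have "\<dots> = e ` I"
        by (simp add: F I_def image_image)
      finally show "F ` carrier S = carrier ?L"
        by (simp add: restr_module_def)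
    qed
    ultimately have "rmod_isomorphic R S ?L"
      unfolding rmod_isomorphic_def by blast
    then have "iso_direct_summand R S (rmod_sum ?P ?L)"
      by (rule iso_direct_summand_sum[OF regular_rmod_right_module L])
    \<comment> \<open>At level 0 the simple module itself has to be a summand of a projective module
      plus a first syzygy.\<close>
    moreover have "syzygy R (0 + 1) (quotient_rmod R I) ?L"
      using syz(2) by simp
    ultimately show "deloops_at R S 0"
      unfolding deloops_at_def
      using syzygy_0 fg_regular_rmod projective_regular_rmod syz(1) by blast
  qed
  then have "del_module R S \<le> 0" if "simple_right_module R S" for S :: "'a rmod"
    unfolding del_module_def using that by (intro Inf_lower) (auto simp: zero_enat_def)
  then have "del R \<le> 0"
    unfolding del_def by (intro Sup_least) blast
  then show ?thesis by simp
qed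

end


section \<open>A triangular algebra of delooping level zero\<close>

text \<open>Over a commutative ring the side of the action is immaterial, so the results on right
  modules apply to \<open>A\<close> as a module over its base ring \<open>R\<close>.\<close>

lemma module_iff_right_module: "cring R \<Longrightarrow> Module.module R M \<longleftrightarrow> right_module R M"
proof
  assume "Module.module R M"
  then interpret Module.module R M .
  show "right_module R M"
    by (intro right_module.intro right_module_axioms.intro)
      (auto simp: R.ring_axioms M.abelian_group_axioms smult_l_distr smult_r_distr R.m_comm
        simp flip: smult_assoc1)
next
  assume R: "cring R" and "right_module R M"
  then interpret cring R + right_module R M .
  show "Module.module R M"
  proof (rule moduleI)
    fix a b x assume "a \<in> carrier R" "b \<in> carrier R" "x \<in> carrier M"
    then show "(a \<otimes>\<^bsub>R\<^esub> b) \<odot>\<^bsub>M\<^esub> x = a \<odot>\<^bsub>M\<^esub> (b \<odot>\<^bsub>M\<^esub> x)"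
      using ract_assoc[of b a x] by (simp add: m_comm)
  qed (auto simp: R M.abelian_group_axioms ract_closed ract_add_ring ract_add_module ract_one)
qed

lemma op_algebra_simps [simp]:
  "carrier (op_algebra A) = carrier A" "\<one>\<^bsub>op_algebra A\<^esub> = \<one>\<^bsub>A\<^esub>" "\<zero>\<^bsub>op_algebra A\<^esub> = \<zero>\<^bsub>A\<^esub>"
  "x \<oplus>\<^bsub>op_algebra A\<^esub> y = x \<oplus>\<^bsub>A\<^esub> y" "x \<otimes>\<^bsub>op_algebra A\<^esub> y = y \<otimes>\<^bsub>A\<^esub> x"
  "r \<odot>\<^bsub>op_algebra A\<^esub> x = r \<odot>\<^bsub>A\<^esub> x" "op_algebra (op_algebra A) = A"
  by (simp_all add: op_algebra_def)

lemma assoc_algebraI: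
  assumes "cring R" "right_module R A"
    and "\<And>x y. x \<in> carrier A \<Longrightarrow> y \<in> carrier A \<Longrightarrow> x \<otimes>\<^bsub>A\<^esub> y \<in> carrier A"
    and "\<And>x y z. x \<in> carrier A \<Longrightarrow> y \<in> carrier A \<Longrightarrow> z \<in> carrier A \<Longrightarrow>
      (x \<otimes>\<^bsub>A\<^esub> y) \<otimes>\<^bsub>A\<^esub> z = x \<otimes>\<^bsub>A\<^esub> (y \<otimes>\<^bsub>A\<^esub> z)"
    and "\<one>\<^bsub>A\<^esub> \<in> carrier A"
    and "\<And>x. x \<in> carrier A \<Longrightarrow> \<one>\<^bsub>A\<^esub> \<otimes>\<^bsub>A\<^esub> x = x"
    and "\<And>x. x \<in> carrier A \<Longrightarrow> x \<otimes>\<^bsub>A\<^esub> \<one>\<^bsub>A\<^esub> = x"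
    and "\<And>x y z. x \<in> carrier A \<Longrightarrow> y \<in> carrier A \<Longrightarrow> z \<in> carrier A \<Longrightarrow>
      (x \<oplus>\<^bsub>A\<^esub> y) \<otimes>\<^bsub>A\<^esub> z = x \<otimes>\<^bsub>A\<^esub> z \<oplus>\<^bsub>A\<^esub> y \<otimes>\<^bsub>A\<^esub> z"
    and "\<And>x y z. x \<in> carrier A \<Longrightarrow> y \<in> carrier A \<Longrightarrow> z \<in> carrier A \<Longrightarrow>
      z \<otimes>\<^bsub>A\<^esub> (x \<oplus>\<^bsub>A\<^esub> y) = z \<otimes>\<^bsub>A\<^esub> x \<oplus>\<^bsub>A\<^esub> z \<otimes>\<^bsub>A\<^esub> y"
    and "\<And>r x y. r \<in> carrier R \<Longrightarrow> x \<in> carrier A \<Longrightarrow> y \<in> carrier A \<Longrightarrow>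
      (r \<odot>\<^bsub>A\<^esub> x) \<otimes>\<^bsub>A\<^esub> y = r \<odot>\<^bsub>A\<^esub> (x \<otimes>\<^bsub>A\<^esub> y)"
    and "\<And>r x y. r \<in> carrier R \<Longrightarrow> x \<in> carrier A \<Longrightarrow> y \<in> carrier A \<Longrightarrow>
      x \<otimes>\<^bsub>A\<^esub> (r \<odot>\<^bsub>A\<^esub> y) = r \<odot>\<^bsub>A\<^esub> (x \<otimes>\<^bsub>A\<^esub> y)"
  shows "assoc_algebra R A"
  using assms
  by (intro assoc_algebra.intro assoc_algebra_axioms.intro ringI monoidI)
    (auto simp: module_iff_right_module right_module_def)

lemma assoc_algebraD:
  assumes "assoc_algebra R A"
  shows "cring R" "right_module R A" "ring A"
proof -
  interpret assoc_algebra R A by fact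
  show "cring R" "ring A" by unfold_locales
  then show "right_module R A"
    using module_axioms by (simp add: module_iff_right_module)
qed

lemma assoc_algebra_op:
  assumes "assoc_algebra R A"
  shows "assoc_algebra R (op_algebra A)"
proof -
  note alg = assoc_algebraD[OF assms]
  interpret A: ring A by (rule alg(3))
  show ?thesis
  proof (rule assoc_algebraI[OF alg(1)])
    show "right_module R (op_algebra A)"
      by (rule right_module_image[of R A "\<lambda>x. x"])
        (auto simp: alg(2) rmod_hom_def)
  qed (auto simp: A.m_assoc A.l_distr A.r_distr assoc_algebra.smult_mult_left[OF assms]
      assoc_algebra.smult_mult_right[OF assms])
qed

lemma artin_algebra_op:
  assumes "artin_algebra R A"
  shows "artin_algebra R (op_algebra A)"
proof -
  have "submodule N R (op_algebra A) \<longleftrightarrow> submodule N R A" for N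
    by (simp add: submodule_def submodule_axioms_def op_algebra_def)
  then show ?thesis
    using assms by (simp add: artin_algebra_def fin_gen_def assoc_algebra_op)
qed

lemma fin_gen_sum:
  assumes M: "right_module A M" "fin_gen A M" and N: "right_module A N" "fin_gen A N"
  shows "fin_gen A (rmod_sum M N)"
proof -
  interpret M: right_module A M by fact
  interpret N: right_module A N by fact
  interpret Y: right_module A "rmod_sum M N" using M N by (intro right_module_sum)
  obtain G where G: "finite G" "G \<subseteq> carrier M"
    "\<And>K. submodule K A M \<Longrightarrow> G \<subseteq> K \<Longrightarrow> K = carrier M"
    using M(2) unfolding fin_gen_def by blast
  obtain H where H: "finite H" "H \<subseteq> carrier N"
    "\<And>K. submodule K A N \<Longrightarrow> H \<subseteq> K \<Longrightarrow> K = carrier N"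
    using N(2) unfolding fin_gen_def by blast
  let ?G = "(\<lambda>g. (g, \<zero>\<^bsub>N\<^esub>)) ` G \<union> (\<lambda>h. (\<zero>\<^bsub>M\<^esub>, h)) ` H"
  have "K = carrier (rmod_sum M N)" if K: "submodule K A (rmod_sum M N)" "?G \<subseteq> K" for K
  proof -
    have KI: "K \<subseteq> carrier M \<times> carrier N" "(\<zero>\<^bsub>M\<^esub>, \<zero>\<^bsub>N\<^esub>) \<in> K"
      "\<And>x y x' y'. (x, y) \<in> K \<Longrightarrow> (x', y') \<in> K \<Longrightarrow> (x \<oplus>\<^bsub>M\<^esub> x', y \<oplus>\<^bsub>N\<^esub> y') \<in> K"
      "\<And>a x y. a \<in> carrier A \<Longrightarrow> (x, y) \<in> K \<Longrightarrow> (a \<odot>\<^bsub>M\<^esub> x, a \<odot>\<^bsub>N\<^esub> y) \<in> K"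
      using K(1) unfolding Y.submodule_iff by (fastforce simp: rmod_sum_def)+
    have "submodule {x \<in> carrier M. (x, \<zero>\<^bsub>N\<^esub>) \<in> K} A M"
      using KI(2) KI(3)[of _ "\<zero>\<^bsub>N\<^esub>" _ "\<zero>\<^bsub>N\<^esub>"] KI(4)[of _ _ "\<zero>\<^bsub>N\<^esub>"]
      by (auto simp: M.submodule_iff M.ract_closed N.ract_zero_right)
    then have 1: "{x \<in> carrier M. (x, \<zero>\<^bsub>N\<^esub>) \<in> K} = carrier M"
      using G(2) K(2) by (intro G(3)) auto
    have "submodule {y \<in> carrier N. (\<zero>\<^bsub>M\<^esub>, y) \<in> K} A N"
      using KI(2) KI(3)[of "\<zero>\<^bsub>M\<^esub>" _ "\<zero>\<^bsub>M\<^esub>"] KI(4)[of _ "\<zero>\<^bsub>M\<^esub>"]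
      by (auto simp: N.submodule_iff N.ract_closed M.ract_zero_right)
    then have 2: "{y \<in> carrier N. (\<zero>\<^bsub>M\<^esub>, y) \<in> K} = carrier N"
      using H(2) K(2) by (intro H(3)) auto
    have "(x, y) \<in> K" if "x \<in> carrier M" "y \<in> carrier N" for x y
    proof -
      have "(x, \<zero>\<^bsub>N\<^esub>) \<in> K" "(\<zero>\<^bsub>M\<^esub>, y) \<in> K" using 1 2 that by blast+
      from KI(3)[OF this] show ?thesis using that by simp
    qed
    then show ?thesis using KI(1) by (auto simp: rmod_sum_def)
  qed
  then show ?thesis
    unfolding fin_gen_def using G(1,2) H(1,2)
    by (intro exI[of _ ?G]) (auto simp: rmod_sum_def)
qed

text \<open>
  With \<open>j\<close> and \<open>pr\<close> identifying \<open>A\<close> with a diagonal corner of \<open>B\<close>, the maximal right ideal \<open>m\<close>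
  of \<open>B\<close> restricts to one of \<open>A\<close>, and \<open>k\<close> embeds \<open>A/J\<close> in \<open>B\<close> with square zero.
\<close>

lemma annihilator_via_corner:
  fixes A :: "('a, 'c) ring_scheme" and B :: "('b, 'd) ring_scheme"
  assumes A: "ring A" and B: "ring B"
    and socle: "\<And>m. maximal_right_ideal m A \<Longrightarrow>
      \<exists>x\<in>carrier A. x \<notin> J \<and> (\<forall>z\<in>m. x \<otimes>\<^bsub>A\<^esub> z \<in> J)"
    and pr: "pr \<in> ring_hom B A"
    and j: "\<And>a. a \<in> carrier A \<Longrightarrow> j a \<in> carrier B" "\<And>a. a \<in> carrier A \<Longrightarrow> pr (j a) = a"
      "\<And>a a'. a \<in> carrier A \<Longrightarrow> a' \<in> carrier A \<Longrightarrow> j (a \<oplus>\<^bsub>A\<^esub> a') = j a \<oplus>\<^bsub>B\<^esub> j a'"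
      "\<And>a b. a \<in> carrier A \<Longrightarrow> b \<in> carrier A \<Longrightarrow> j (a \<otimes>\<^bsub>A\<^esub> b) = j a \<otimes>\<^bsub>B\<^esub> j b"
    and k: "\<And>x. x \<in> carrier A \<Longrightarrow> k x \<in> carrier B"
      "\<And>x. x \<in> carrier A \<Longrightarrow> k x = \<zero>\<^bsub>B\<^esub> \<longleftrightarrow> x \<in> J"
      "\<And>x b. x \<in> carrier A \<Longrightarrow> b \<in> carrier B \<Longrightarrow> k x \<otimes>\<^bsub>B\<^esub> b = k (x \<otimes>\<^bsub>A\<^esub> pr b)"
      "\<And>x y. x \<in> carrier A \<Longrightarrow> y \<in> carrier A \<Longrightarrow> k x \<otimes>\<^bsub>B\<^esub> k y = \<zero>\<^bsub>B\<^esub>"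
    and m: "maximal_right_ideal m B" "j \<one>\<^bsub>A\<^esub> \<notin> m" "\<And>y. y \<in> m \<Longrightarrow> j (pr y) \<in> m"
  shows "\<exists>b\<in>carrier B. b \<noteq> \<zero>\<^bsub>B\<^esub> \<and> (\<forall>y\<in>m. b \<otimes>\<^bsub>B\<^esub> y = \<zero>\<^bsub>B\<^esub>) \<and>
    (\<forall>c\<in>carrier B. b \<otimes>\<^bsub>B\<^esub> c \<otimes>\<^bsub>B\<^esub> b = \<zero>\<^bsub>B\<^esub>)"
proof -
  interpret A: ring A by fact
  interpret B: ring B by fact
  note mI = B.right_idealD[OF B.maximal_right_idealD(1)[OF m(1)]]
  have pr_closed: "pr b \<in> carrier A" if "b \<in> carrier B" for b
    using pr that by (auto simp: ring_hom_def)
  have pr_minus: "pr (x \<ominus>\<^bsub>B\<^esub> y) = pr x \<ominus>\<^bsub>A\<^esub> pr y" if "x \<in> carrier B" "y \<in> carrier B" for x y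
  proof -
    have "pr y \<oplus>\<^bsub>A\<^esub> pr (x \<ominus>\<^bsub>B\<^esub> y) = pr x"
      using that ring_hom_add[OF pr, of y "x \<ominus>\<^bsub>B\<^esub> y"] by (simp add: B.add_diff_cancel)
    then show ?thesis
      using that pr_closed[of y] pr_closed[of "x \<ominus>\<^bsub>B\<^esub> y"]
      by (simp add: A.minus_eq A.a_comm[of "pr y"] A.a_assoc A.r_neg flip: \<open>_ = pr x\<close>)
  qed
  have j0: "j \<zero>\<^bsub>A\<^esub> = \<zero>\<^bsub>B\<^esub>"
    using j(1,3)[of "\<zero>\<^bsub>A\<^esub>"] j(3)[of "\<zero>\<^bsub>A\<^esub>" "\<zero>\<^bsub>A\<^esub>"] by (metis A.l_zero A.zero_closed B.add.r_cancel_one')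
  \<comment> \<open>The contraction of \<open>m\<close> along \<open>j\<close>. It is proper because
    \<open>j\<close> of the unit, an idempotent of \<open>B\<close>, is assumed to lie outside
    \<open>m\<close>.\<close>
  let ?m = "{a \<in> carrier A. j a \<in> m}"
  have "right_ideal ?m A"
    using j0 mI j(1) by (auto simp: A.right_ideal_iff j(3,4))
  moreover have "\<exists>c\<in>carrier A. \<one>\<^bsub>A\<^esub> \<ominus>\<^bsub>A\<^esub> x \<otimes>\<^bsub>A\<^esub> c \<in> ?m" if x: "x \<in> carrier A - ?m" for x
  proof -
    have "j x \<in> carrier B" "j x \<notin> m" using x j(1) by auto
    then obtain d where d: "d \<in> carrier B" "\<one>\<^bsub>B\<^esub> \<ominus>\<^bsub>B\<^esub> j x \<otimes>\<^bsub>B\<^esub> d \<in> m"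
      using B.maximal_right_idealD(3)[OF m(1)] by blast
    \<comment> \<open>The composite of \<open>pr\<close> and \<open>j\<close> maps \<open>m\<close>
      into itself, so the witness \<open>d\<close> in \<open>B\<close> descends to the witness
      \<open>pr d\<close> in \<open>A\<close>.\<close>
    have "pr (\<one>\<^bsub>B\<^esub> \<ominus>\<^bsub>B\<^esub> j x \<otimes>\<^bsub>B\<^esub> d) = \<one>\<^bsub>A\<^esub> \<ominus>\<^bsub>A\<^esub> x \<otimes>\<^bsub>A\<^esub> pr d"
      using d(1) x j(1,2) ring_hom_mult[OF pr] ring_hom_one[OF pr] by (simp add: pr_minus)
    then show ?thesis
      using m(3)[OF d(2)] pr_closed[OF d(1)] x by (intro bexI[of _ "pr d"]) auto
  qed
  ultimately have "maximal_right_ideal ?m A"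
    using m(2) by (auto simp: maximal_right_ideal_def)
  then obtain x where x: "x \<in> carrier A" "x \<notin> J" "\<And>z. z \<in> ?m \<Longrightarrow> x \<otimes>\<^bsub>A\<^esub> z \<in> J"
    using socle by blast
  \<comment> \<open>The product equals \<open>k (x (pr y))\<close>. Since \<open>pr y\<close> lies
    in the contracted ideal, \<open>x (pr y)\<close> lies in \<open>J\<close>, where
    \<open>k\<close> vanishes.\<close>
  have "k x \<otimes>\<^bsub>B\<^esub> y = \<zero>\<^bsub>B\<^esub>" if "y \<in> m" for y
    using that m(3) mI(1) pr_closed x by (simp add: k(2,3))
  moreover have "k x \<otimes>\<^bsub>B\<^esub> c \<otimes>\<^bsub>B\<^esub> k x = \<zero>\<^bsub>B\<^esub>" if "c \<in> carrier B" for c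
    using that x pr_closed by (simp add: k(3,4))
  ultimately show ?thesis
    using k(1,2) x(1,2) by blast
qed

text \<open>The quadruple \<open>(c, s, m, a)\<close> is the matrix with rows
  \<open>((c, s), m)\<close> and \<open>(0, a)\<close>, where \<open>(c, s)\<close> belongs to the
  trivial extension of \<open>A\<close> by itself. The component \<open>s\<close> acts as zero on
  \<open>m\<close>, so no product of \<open>s\<close> with \<open>m'\<close> occurs.\<close>

definition quadruple_algebra :: "('r, 'a) module \<Rightarrow> ('r, 'a \<times> 'a \<times> 'a \<times> 'a) module" where
  "quadruple_algebra A = (rmod_sum A (rmod_sum A (rmod_sum A A)))
    \<lparr>mult := (\<lambda>(c, s, m, a) (c', s', m', a').
       (c \<otimes>\<^bsub>A\<^esub> c', c \<otimes>\<^bsub>A\<^esub> s' \<oplus>\<^bsub>A\<^esub> s \<otimes>\<^bsub>A\<^esub> c', c \<otimes>\<^bsub>A\<^esub> m' \<oplus>\<^bsub>A\<^esub> m \<otimes>\<^bsub>A\<^esub> a', a \<otimes>\<^bsub>A\<^esub> a')),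
     one := (\<one>\<^bsub>A\<^esub>, \<zero>\<^bsub>A\<^esub>, \<zero>\<^bsub>A\<^esub>, \<one>\<^bsub>A\<^esub>)\<rparr>"

lemma quadruple_algebra_simps [simp]:
  "carrier (quadruple_algebra A) = carrier A \<times> carrier A \<times> carrier A \<times> carrier A"
  "\<zero>\<^bsub>quadruple_algebra A\<^esub> = (\<zero>\<^bsub>A\<^esub>, \<zero>\<^bsub>A\<^esub>, \<zero>\<^bsub>A\<^esub>, \<zero>\<^bsub>A\<^esub>)"
  "\<one>\<^bsub>quadruple_algebra A\<^esub> = (\<one>\<^bsub>A\<^esub>, \<zero>\<^bsub>A\<^esub>, \<zero>\<^bsub>A\<^esub>, \<one>\<^bsub>A\<^esub>)"
  "(c, s, m, a) \<oplus>\<^bsub>quadruple_algebra A\<^esub> (c', s', m', a') =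
    (c \<oplus>\<^bsub>A\<^esub> c', s \<oplus>\<^bsub>A\<^esub> s', m \<oplus>\<^bsub>A\<^esub> m', a \<oplus>\<^bsub>A\<^esub> a')"
  "(c, s, m, a) \<otimes>\<^bsub>quadruple_algebra A\<^esub> (c', s', m', a') =
    (c \<otimes>\<^bsub>A\<^esub> c', c \<otimes>\<^bsub>A\<^esub> s' \<oplus>\<^bsub>A\<^esub> s \<otimes>\<^bsub>A\<^esub> c', c \<otimes>\<^bsub>A\<^esub> m' \<oplus>\<^bsub>A\<^esub> m \<otimes>\<^bsub>A\<^esub> a', a \<otimes>\<^bsub>A\<^esub> a')"
  "r \<odot>\<^bsub>quadruple_algebra A\<^esub> (c, s, m, a) = (r \<odot>\<^bsub>A\<^esub> c, r \<odot>\<^bsub>A\<^esub> s, r \<odot>\<^bsub>A\<^esub> m, r \<odot>\<^bsub>A\<^esub> a)"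
  by (simp_all add: quadruple_algebra_def rmod_sum_def)

text \<open>
  The quotient of \<^const>\<open>quadruple_algebra\<close> by \<open>0 \<times> J \<times> J \<times> 0\<close>, that is, the matrix algebra
  \<open>[[\<Lambda>, A/J], [0, A]]\<close> over the trivial extension \<open>\<Lambda> = A \<ltimes> A/J\<close>. The injection \<open>enc\<close>
  moves it to the type of the elements of \<open>A\<close>.
\<close>

definition tri_encode ::
  "('a \<times> 'a \<times> 'a \<times> 'a \<Rightarrow> 'a) \<Rightarrow> ('r, 'a) module \<Rightarrow> 'a \<times> 'a \<times> 'a \<times> 'a \<Rightarrow> 'a" where
  "tri_encode enc A = (\<lambda>(c, s, m, a). enc (c, coset_rep A (jacobson_radical A) s,
    coset_rep A (jacobson_radical A) m, a))"

definition tri_algebra ::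
  "('a \<times> 'a \<times> 'a \<times> 'a \<Rightarrow> 'a) \<Rightarrow> ('r, 'a) module \<Rightarrow> ('r, 'a) module" where
  "tri_algebra enc A = image_module (tri_encode enc A) (quadruple_algebra A)"

section \<open>The triangular algebra and its two diagonal corners\<close>

locale triangular_construction =
  fixes R :: "('r, 'c) ring_scheme" and A :: "('r, 'a) module"
    and enc :: "'a \<times> 'a \<times> 'a \<times> 'a \<Rightarrow> 'a"
  assumes artin: "artin_algebra R A" and inj_enc: "inj enc"
begin

lemma alg: "assoc_algebra R A" and artinian: "artinian_cring R" and fin_gen: "fin_gen R A"
  using artin by (auto simp: artin_algebra_def)

sublocale A: ring A
  by (rule assoc_algebraD(3)[OF alg])

sublocale RA: right_module R A
  by (rule assoc_algebraD(2)[OF alg])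

lemma smult_mult_left:
  "r \<in> carrier R \<Longrightarrow> x \<in> carrier A \<Longrightarrow> y \<in> carrier A \<Longrightarrow>
    (r \<odot>\<^bsub>A\<^esub> x) \<otimes>\<^bsub>A\<^esub> y = r \<odot>\<^bsub>A\<^esub> (x \<otimes>\<^bsub>A\<^esub> y)"
  by (rule assoc_algebra.smult_mult_left[OF alg])

lemma smult_mult_right:
  "r \<in> carrier R \<Longrightarrow> x \<in> carrier A \<Longrightarrow> y \<in> carrier A \<Longrightarrow>
    x \<otimes>\<^bsub>A\<^esub> (r \<odot>\<^bsub>A\<^esub> y) = r \<odot>\<^bsub>A\<^esub> (x \<otimes>\<^bsub>A\<^esub> y)"
  by (rule assoc_algebra.smult_mult_right[OF alg])

abbreviation J :: "'a set" where "J \<equiv> jacobson_radical A"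
abbreviation \<rho> :: "'a \<Rightarrow> 'a" where "\<rho> \<equiv> coset_rep A J"
abbreviation \<phi> :: "'a \<times> 'a \<times> 'a \<times> 'a \<Rightarrow> 'a" where "\<phi> \<equiv> tri_encode enc A"
abbreviation Q :: "('r, 'a \<times> 'a \<times> 'a \<times> 'a) module" where "Q \<equiv> quadruple_algebra A"
abbreviation B :: "('r, 'a) module" where "B \<equiv> tri_algebra enc A"

text \<open>A scalar \<open>r\<close> acts as right multiplication by the element
  \<open>r 1\<close>. Right ideals are therefore submodules over \<open>R\<close> and inherit the
  chain condition.\<close>

lemma right_ideal_smult:
  assumes "right_ideal I A" "r \<in> carrier R" "x \<in> I"
  shows "r \<odot>\<^bsub>A\<^esub> x \<in> I"
proof -
  have x: "x \<in> carrier A" using A.right_idealD(1)[OF assms(1,3)] .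
  then have "r \<odot>\<^bsub>A\<^esub> x = x \<otimes>\<^bsub>A\<^esub> (r \<odot>\<^bsub>A\<^esub> \<one>\<^bsub>A\<^esub>)"
    using assms(2) by (simp add: smult_mult_right)
  then show ?thesis
    using A.right_idealD(5)[OF assms(1,3)] assms(2) RA.ract_closed by simp
qed

lemma right_ideal_submodule: "right_ideal I A \<Longrightarrow> submodule I R A"
  using right_ideal_smult A.right_idealD[of I] unfolding RA.submodule_iff by blast

lemma socle:
  assumes "maximal_right_ideal m A"
  shows "\<exists>x\<in>carrier A. x \<notin> J \<and> (\<forall>z\<in>m. x \<otimes>\<^bsub>A\<^esub> z \<in> J)"
proof -
  have "\<exists>I\<in>S. \<forall>I'\<in>S. I' \<subseteq> I \<longrightarrow> I' = I"
    if "S \<noteq> {}" "\<And>I. I \<in> S \<Longrightarrow> right_ideal I A" for S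
    using submodule_minimal[OF artinian RA.right_module_axioms fin_gen, of S]
      right_ideal_submodule that by metis
  from A.maximal_right_ideal_socle[OF this assms] show ?thesis by metis
qed

lemma phi_eq_iff: "\<phi> (c, s, m, a) = \<phi> (c', s', m', a') \<longleftrightarrow>
    c = c' \<and> \<rho> s = \<rho> s' \<and> \<rho> m = \<rho> m' \<and> a = a'"
  by (auto simp: tri_encode_def inj_eq[OF inj_enc])

lemmas J_right_ideal = A.jacobson_radical_right_ideal

lemma rho_smult:
  assumes "r \<in> carrier R" "x \<in> carrier A" "x' \<in> carrier A" "\<rho> x = \<rho> x'"
  shows "\<rho> (r \<odot>\<^bsub>A\<^esub> x) = \<rho> (r \<odot>\<^bsub>A\<^esub> x')"
proof -
  have "\<rho> (x \<otimes>\<^bsub>A\<^esub> (r \<odot>\<^bsub>A\<^esub> \<one>\<^bsub>A\<^esub>)) = \<rho> (x' \<otimes>\<^bsub>A\<^esub> (r \<odot>\<^bsub>A\<^esub> \<one>\<^bsub>A\<^esub>))"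
    using assms RA.ract_closed by (intro A.coset_rep_right_mult[OF J_right_ideal]) auto
  then show ?thesis using assms by (simp add: smult_mult_right)
qed

text \<open>The fibres of \<open>\<phi>\<close> are the cosets of
  \<open>0 \<times> J \<times> J \<times> 0\<close>. The products \<open>c s'\<close> and
  \<open>c m'\<close> make it necessary that \<open>J\<close> is closed under left multiplication as
  well.\<close>

lemma phi_compat: "add_compat Q \<phi>" "mult_compat Q \<phi>" "smult_compat R Q \<phi>"
proof -
  note rho_mult = A.coset_rep_right_mult[OF J_right_ideal]
    A.coset_rep_left_mult[OF J_right_ideal A.jacobson_radical_left_mult]
  show "add_compat Q \<phi>"
    by (auto simp: add_compat_def phi_eq_iff intro: A.coset_rep_add[OF J_right_ideal])
  show "mult_compat Q \<phi>"
    by (auto simp: mult_compat_def phi_eq_iff intro!: A.coset_rep_add[OF J_right_ideal] rho_mult)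
  show "smult_compat R Q \<phi>"
    by (auto simp: smult_compat_def phi_eq_iff intro: rho_smult)
qed

lemma B_carrier: "carrier B = \<phi> ` (carrier A \<times> carrier A \<times> carrier A \<times> carrier A)"
  by (simp add: tri_algebra_def image_module_simps)

lemma B_zero: "\<zero>\<^bsub>B\<^esub> = \<phi> (\<zero>\<^bsub>A\<^esub>, \<zero>\<^bsub>A\<^esub>, \<zero>\<^bsub>A\<^esub>, \<zero>\<^bsub>A\<^esub>)"
  by (simp add: tri_algebra_def image_module_simps)

lemma B_one: "\<one>\<^bsub>B\<^esub> = \<phi> (\<one>\<^bsub>A\<^esub>, \<zero>\<^bsub>A\<^esub>, \<zero>\<^bsub>A\<^esub>, \<one>\<^bsub>A\<^esub>)"
  by (simp add: tri_algebra_def image_module_simps)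

lemma phi_closed:
  "c \<in> carrier A \<Longrightarrow> s \<in> carrier A \<Longrightarrow> m \<in> carrier A \<Longrightarrow> a \<in> carrier A \<Longrightarrow> \<phi> (c, s, m, a) \<in> carrier B"
  by (auto simp: B_carrier)

lemma phi_hom:
  assumes "x \<in> carrier Q" "y \<in> carrier Q"
  shows "\<phi> x \<oplus>\<^bsub>B\<^esub> \<phi> y = \<phi> (x \<oplus>\<^bsub>Q\<^esub> y)" "\<phi> x \<otimes>\<^bsub>B\<^esub> \<phi> y = \<phi> (x \<otimes>\<^bsub>Q\<^esub> y)"
  unfolding tri_algebra_def
  using assms image_module_add[OF phi_compat(1)] image_module_mult[OF phi_compat(2)] by auto

lemma phi_smult:
  "r \<in> carrier R \<Longrightarrow> x \<in> carrier Q \<Longrightarrow> r \<odot>\<^bsub>B\<^esub> \<phi> x = \<phi> (r \<odot>\<^bsub>Q\<^esub> x)"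
  unfolding tri_algebra_def by (rule image_module_smult[OF phi_compat(3)])

lemma phi_cases:
  assumes "b \<in> carrier B"
  obtains c s m a where "c \<in> carrier A" "s \<in> carrier A" "m \<in> carrier A" "a \<in> carrier A"
    "b = \<phi> (c, s, m, a)"
  using assms that by (auto simp: B_carrier)

lemma Q_right_module: "right_module R Q"
proof (rule right_module_image)
  show "right_module R (rmod_sum A (rmod_sum A (rmod_sum A A)))"
    by (intro right_module_sum RA.right_module_axioms)
  show "(\<lambda>x. x) \<in> rmod_hom R (rmod_sum A (rmod_sum A (rmod_sum A A))) Q"
    by (auto simp: rmod_hom_def quadruple_algebra_def)
qed (auto simp: quadruple_algebra_def)

lemma Q_fin_gen: "fin_gen R Q"
proof (rule fin_gen_image)
  show "right_module R (rmod_sum A (rmod_sum A (rmod_sum A A)))"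
    "fin_gen R (rmod_sum A (rmod_sum A (rmod_sum A A)))"
    by (intro right_module_sum fin_gen_sum fin_gen RA.right_module_axioms)+
  show "right_module R Q" by (rule Q_right_module)
  show "(\<lambda>x. x) \<in> rmod_hom R (rmod_sum A (rmod_sum A (rmod_sum A A))) Q"
    by (auto simp: rmod_hom_def quadruple_algebra_def)
qed (auto simp: quadruple_algebra_def)

lemma B_right_module: "right_module R B"
  unfolding tri_algebra_def by (intro right_module_image_module Q_right_module phi_compat)

lemma B_assoc_algebra: "assoc_algebra R B"
  by (rule assoc_algebraI[OF assoc_algebraD(1)[OF alg] B_right_module])
    (auto simp: B_carrier B_one phi_hom phi_smult A.m_assoc A.l_distr A.r_distr A.a_ac
      smult_mult_left smult_mult_right RA.ract_add_module RA.ract_closed intro!: imageI)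

lemma B_artin_algebra: "artin_algebra R B"
proof -
  have "fin_gen R B"
    unfolding tri_algebra_def
    by (rule fin_gen_image[OF Q_right_module _ image_module_hom[OF phi_compat(1,3)] _ Q_fin_gen])
      (use B_right_module in \<open>simp_all add: tri_algebra_def image_module_simps\<close>)
  then show ?thesis
    using artinian B_assoc_algebra by (simp add: artin_algebra_def)
qed

sublocale B: ring B
  by (rule assoc_algebraD(3)[OF B_assoc_algebra])

text \<open>The two diagonal projections to \<open>A\<close>. Reading off these components of an
  arbitrary preimage is sound because the code determines them exactly, whereas \<open>s\<close> and
  \<open>m\<close> are determined only modulo \<open>J\<close>.\<close>

definition corner1 :: "'a \<Rightarrow> 'a" where "corner1 b = fst (inv_into (carrier Q) \<phi> b)"
definition corner2 :: "'a \<Rightarrow> 'a" where "corner2 b = snd (snd (snd (inv_into (carrier Q) \<phi> b)))"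

lemma corner_phi:
  assumes "c \<in> carrier A" "s \<in> carrier A" "m \<in> carrier A" "a \<in> carrier A"
  shows "corner1 (\<phi> (c, s, m, a)) = c" "corner2 (\<phi> (c, s, m, a)) = a"
proof -
  let ?u = "inv_into (carrier Q) \<phi> (\<phi> (c, s, m, a))"
  obtain c' s' m' a' where u: "?u = (c', s', m', a')" by (cases ?u)
  have "\<phi> ?u = \<phi> (c, s, m, a)"
    using assms by (intro f_inv_into_f) auto
  then show "corner1 (\<phi> (c, s, m, a)) = c" "corner2 (\<phi> (c, s, m, a)) = a"
    unfolding corner1_def corner2_def u by (simp_all add: phi_eq_iff)
qed

lemma corner_ring_hom: "corner1 \<in> ring_hom B A" "corner2 \<in> ring_hom B A"
  by (auto simp: ring_hom_def B_carrier B_one phi_hom corner_phi)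

text \<open>A maximal right ideal contains the nilpotent ideal of all \<open>(0, s, t, 0)\<close>
  and misses one of the two diagonal idempotents. The missed idempotent tells which copy of
  \<open>A/J\<close> receives the simple quotient: the \<open>s\<close> component for the upper one,
  the \<open>m\<close> component for the lower one.\<close>

lemma B_maximal_annihilated:
  assumes m: "maximal_right_ideal m B"
  shows "\<exists>b\<in>carrier B. b \<noteq> \<zero>\<^bsub>B\<^esub> \<and> (\<forall>y\<in>m. b \<otimes>\<^bsub>B\<^esub> y = \<zero>\<^bsub>B\<^esub>) \<and>
    (\<forall>c\<in>carrier B. b \<otimes>\<^bsub>B\<^esub> c \<otimes>\<^bsub>B\<^esub> b = \<zero>\<^bsub>B\<^esub>)"
proof -
  note mI = B.right_idealD[OF B.maximal_right_idealD(1)[OF m]]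
  \<comment> \<open>Otherwise \<open>1 - n d\<close> lies in \<open>m\<close> for some
    \<open>d\<close>. As \<open>n d\<close> has square zero, multiplying by \<open>1 + n d\<close>
    gives 1, so \<open>m\<close> would not be proper.\<close>
  have nil: "\<phi> (\<zero>\<^bsub>A\<^esub>, s, t, \<zero>\<^bsub>A\<^esub>) \<in> m" if st: "s \<in> carrier A" "t \<in> carrier A" for s t
  proof (rule ccontr)
    let ?n = "\<phi> (\<zero>\<^bsub>A\<^esub>, s, t, \<zero>\<^bsub>A\<^esub>)"
    assume "?n \<notin> m"
    moreover have n: "?n \<in> carrier B" using st by (simp add: phi_closed)
    ultimately obtain d where d: "d \<in> carrier B" "\<one>\<^bsub>B\<^esub> \<ominus>\<^bsub>B\<^esub> ?n \<otimes>\<^bsub>B\<^esub> d \<in> m"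
      using B.maximal_right_idealD(3)[OF m] by blast
    have sq: "?n \<otimes>\<^bsub>B\<^esub> d \<otimes>\<^bsub>B\<^esub> ?n = \<zero>\<^bsub>B\<^esub>"
      using d(1) st by (cases rule: phi_cases) (simp add: phi_hom B_zero)
    let ?nd = "?n \<otimes>\<^bsub>B\<^esub> d"
    have nd: "?nd \<in> carrier B" using n d(1) by simp
    have "?nd \<otimes>\<^bsub>B\<^esub> ?nd = \<zero>\<^bsub>B\<^esub>"
      using sq n d(1) nd by (simp flip: B.m_assoc)
    then have "(\<one>\<^bsub>B\<^esub> \<ominus>\<^bsub>B\<^esub> ?nd) \<otimes>\<^bsub>B\<^esub> (\<one>\<^bsub>B\<^esub> \<oplus>\<^bsub>B\<^esub> ?nd) = \<one>\<^bsub>B\<^esub>"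
      using nd by (simp add: B.minus_eq B.r_distr B.l_distr B.l_minus B.a_assoc B.l_neg)
    then show False
      using mI(5)[OF d(2), of "\<one>\<^bsub>B\<^esub> \<oplus>\<^bsub>B\<^esub> ?nd"] nd B.maximal_right_idealD(2)[OF m] by simp
  qed
  let ?e = "\<phi> (\<one>\<^bsub>A\<^esub>, \<zero>\<^bsub>A\<^esub>, \<zero>\<^bsub>A\<^esub>, \<zero>\<^bsub>A\<^esub>)" and ?f = "\<phi> (\<zero>\<^bsub>A\<^esub>, \<zero>\<^bsub>A\<^esub>, \<zero>\<^bsub>A\<^esub>, \<one>\<^bsub>A\<^esub>)"
  have "?e \<oplus>\<^bsub>B\<^esub> ?f = \<one>\<^bsub>B\<^esub>" by (simp add: phi_hom B_one)
  then consider "?e \<notin> m" | "?f \<notin> m"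
    using mI(3) B.maximal_right_idealD(2)[OF m] by metis
  then show ?thesis
  proof cases
    case 1
    have "\<phi> (corner1 y, \<zero>\<^bsub>A\<^esub>, \<zero>\<^bsub>A\<^esub>, \<zero>\<^bsub>A\<^esub>) \<in> m" if y: "y \<in> m" for y
    proof -
      from mI(1)[OF y] obtain c s t a where c: "c \<in> carrier A" "s \<in> carrier A" "t \<in> carrier A"
        "a \<in> carrier A" "y = \<phi> (c, s, t, a)" by (rule phi_cases)
      \<comment> \<open>Right multiplication by \<open>?e\<close> leaves
        \<open>(c, s, 0, 0)\<close>; the unwanted \<open>s\<close> is removed by subtracting an
        element of the nilpotent ideal.\<close>
      have "y \<otimes>\<^bsub>B\<^esub> ?e \<ominus>\<^bsub>B\<^esub> \<phi> (\<zero>\<^bsub>A\<^esub>, s, \<zero>\<^bsub>A\<^esub>, \<zero>\<^bsub>A\<^esub>) \<in> m"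
        using mI(4)[OF mI(5)[OF y] nil] c by (simp add: phi_closed)
      moreover have "y \<otimes>\<^bsub>B\<^esub> ?e = \<phi> (c, \<zero>\<^bsub>A\<^esub>, \<zero>\<^bsub>A\<^esub>, \<zero>\<^bsub>A\<^esub>) \<oplus>\<^bsub>B\<^esub> \<phi> (\<zero>\<^bsub>A\<^esub>, s, \<zero>\<^bsub>A\<^esub>, \<zero>\<^bsub>A\<^esub>)"
        using c by (simp add: phi_hom)
      ultimately show ?thesis
        using c by (simp add: B.minus_eq B.a_assoc B.r_neg phi_closed corner_phi)
    qed
    then show ?thesis
      using 1 A.coset_rep_eq_zero_iff[OF J_right_ideal]
      by (intro annihilator_via_corner[where A = A and J = J and pr = corner1 and m = m
            and j = "\<lambda>a. \<phi> (a, \<zero>\<^bsub>A\<^esub>, \<zero>\<^bsub>A\<^esub>, \<zero>\<^bsub>A\<^esub>)" and k = "\<lambda>x. \<phi> (\<zero>\<^bsub>A\<^esub>, x, \<zero>\<^bsub>A\<^esub>, \<zero>\<^bsub>A\<^esub>)"])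
        (auto simp: A.ring_axioms B.ring_axioms socle corner_ring_hom phi_closed corner_phi phi_hom
          B_zero phi_eq_iff m elim!: phi_cases)
  next
    case 2
    have "\<phi> (\<zero>\<^bsub>A\<^esub>, \<zero>\<^bsub>A\<^esub>, \<zero>\<^bsub>A\<^esub>, corner2 y) \<in> m" if y: "y \<in> m" for y
    proof -
      from mI(1)[OF y] obtain c s t a where c: "c \<in> carrier A" "s \<in> carrier A" "t \<in> carrier A"
        "a \<in> carrier A" "y = \<phi> (c, s, t, a)" by (rule phi_cases)
      \<comment> \<open>Right multiplication by \<open>?f\<close> keeps the second column
        \<open>(0, 0, t, a)\<close>; here it is \<open>t\<close> that has to be subtracted.\<close>
      have "y \<otimes>\<^bsub>B\<^esub> ?f \<ominus>\<^bsub>B\<^esub> \<phi> (\<zero>\<^bsub>A\<^esub>, \<zero>\<^bsub>A\<^esub>, t, \<zero>\<^bsub>A\<^esub>) \<in> m"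
        using mI(4)[OF mI(5)[OF y] nil] c by (simp add: phi_closed)
      moreover have "y \<otimes>\<^bsub>B\<^esub> ?f = \<phi> (\<zero>\<^bsub>A\<^esub>, \<zero>\<^bsub>A\<^esub>, \<zero>\<^bsub>A\<^esub>, a) \<oplus>\<^bsub>B\<^esub> \<phi> (\<zero>\<^bsub>A\<^esub>, \<zero>\<^bsub>A\<^esub>, t, \<zero>\<^bsub>A\<^esub>)"
        using c by (simp add: phi_hom)
      ultimately show ?thesis
        using c by (simp add: B.minus_eq B.a_assoc B.r_neg phi_closed corner_phi)
    qed
    then show ?thesis
      using 2 A.coset_rep_eq_zero_iff[OF J_right_ideal]
      by (intro annihilator_via_corner[where A = A and J = J and pr = corner2 and m = m
            and j = "\<lambda>a. \<phi> (\<zero>\<^bsub>A\<^esub>, \<zero>\<^bsub>A\<^esub>, \<zero>\<^bsub>A\<^esub>, a)" and k = "\<lambda>x. \<phi> (\<zero>\<^bsub>A\<^esub>, \<zero>\<^bsub>A\<^esub>, x, \<zero>\<^bsub>A\<^esub>)"])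
        (auto simp: A.ring_axioms B.ring_axioms socle corner_ring_hom phi_closed corner_phi phi_hom
          B_zero phi_eq_iff m elim!: phi_cases)
  qed
qed

lemma del_B: "del B = 0"
  by (rule B.del_eq_0) (rule B_maximal_annihilated)

text \<open>In the opposite algebra \<open>mult_idem\<close> is a statement on left multiplication
  in \<open>B\<close>: multiplying by the lower idempotent selects the second row
  \<open>(0, a)\<close>, which involves only \<open>A\<close>. The second column also contains the
  entry \<open>m\<close>, which is why the opposite algebra is taken.\<close>

lemma del_op_le: "del (op_algebra A) \<le> del (op_algebra B)"
proof -
  have "corner_ring (op_algebra B) (op_algebra A) corner2
      (\<lambda>a. \<phi> (\<zero>\<^bsub>A\<^esub>, \<zero>\<^bsub>A\<^esub>, \<zero>\<^bsub>A\<^esub>, a))"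
  proof (intro corner_ring.intro corner_ring_axioms.intro)
    show "ring (op_algebra B)" "ring (op_algebra A)"
      using assoc_algebraD(3) assoc_algebra_op alg B_assoc_algebra by blast+
    show "corner2 \<in> ring_hom (op_algebra B) (op_algebra A)"
      using corner_ring_hom(2) by (auto simp: ring_hom_def)
  qed (auto simp: phi_closed corner_phi phi_hom B_carrier)
  then show ?thesis by (rule corner_ring.del_corner_le)
qed

end

text \<open>An infinite set is equipotent with its square; nesting an injection of pairs encodes
  quadruples. The two assertions quantify over algebras with elements in one fixed type, so the
  triangular algebra must live in the type of \<open>A\<close>.\<close>

lemma exists_quadruple_encoding:
  assumes "infinite (UNIV :: 'a set)"
  obtains enc :: "'a \<times> 'a \<times> 'a \<times> 'a \<Rightarrow> 'a" where "inj enc"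
proof -
  from ordIso_imp_ordLeq[OF card_of_Times_same_infinite[OF assms], folded card_of_ordLeq]
  obtain f :: "'a \<times> 'a \<Rightarrow> 'a" where f: "inj f"
    by (auto simp flip: UNIV_Times_UNIV)
  have "inj (\<lambda>(x, y, z, w). f (x, f (y, f (z, w))))"
    by (intro injI) (auto simp: inj_eq[OF f])
  then show thesis by (rule that)
qed

theorem proposition2p10:
  assumes "infinite (UNIV :: 'a set)"
  shows "(\<forall>(R :: 'r ring) (A :: ('r, 'a) module). artin_algebra R A \<longrightarrow> del A < \<infinity>)
    \<longleftrightarrow> (\<forall>(R :: 'r ring) (A :: ('r, 'a) module). artin_algebra R A \<longrightarrow>
          del A < \<infinity> \<longrightarrow> del (op_algebra A) < \<infinity>)"
proof (intro iffI allI impI)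
  fix R :: "'r ring" and A :: "('r, 'a) module"
  assume "\<forall>(R :: 'r ring) (A :: ('r, 'a) module). artin_algebra R A \<longrightarrow> del A < \<infinity>"
    and "artin_algebra R A"
  then show "del (op_algebra A) < \<infinity>" using artin_algebra_op by blast
next
  fix R :: "'r ring" and A :: "('r, 'a) module"
  assume ii: "\<forall>(R :: 'r ring) (A :: ('r, 'a) module). artin_algebra R A \<longrightarrow>
      del A < \<infinity> \<longrightarrow> del (op_algebra A) < \<infinity>"
    and A: "artin_algebra R A"
  obtain enc :: "'a \<times> 'a \<times> 'a \<times> 'a \<Rightarrow> 'a" where "inj enc"
    using exists_quadruple_encoding[OF assms] .
  then interpret triangular_construction R "op_algebra A" enc
    using A by (intro triangular_construction.intro artin_algebra_op)
  have "del B < \<infinity>" by (simp add: del_B)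
  then have "del (op_algebra B) < \<infinity>"
    using ii B_artin_algebra by blast
  moreover have "del A \<le> del (op_algebra B)"
    using del_op_le by (simp only: op_algebra_simps)
  ultimately show "del A < \<infinity>"
    by (rule le_less_trans[rotated])
qed

end
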